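(* Let $(Z,d)$ be a nonempty compact metric space, and let $X$ be a hyperbolic filling of $Z$ in the sense of Bonk–Schramm, of Bourdon–Pajot, or of Buyalo–Schroeder. Then $X$ is boundary rigid if and only if $Z$ is uniformly perfect.
   Context: Uniformly perfect: $(Z,d)$ is uniformly perfect if there are $S\ge1$, $r_0>0$ such that for each $x\in Z$ and $0<r\le r_0$ there is $y\in Z$ with $r/S<d(x,y)\le r$. Quasi-isometries: $f:(X,d)\to(Y,d')$ is a quasi-isometry if for some $K\ge1$, $C\ge0$ one has $K^{-1}d(x,y)-C\le d'(f(x),f(y))\le Kd(x,y)+C$ for all $x,y\in X$ and every point of $Y$ is within distance $C$ of $f(X)$. Boundary: for $w\in X$, $(x|y)_w=\frac12(d(x,w)+d(y,w)-d(x,y))$. A sequence $\{x_i\}$ in $X$ is a Gromov sequence if $(x_i|x_j)_w\to\infty$ as $i,j\to\infty$; two Gromov sequences are equivalent if $(x_i|y_i)_w\to\infty$; $\partial X$ is the set of equivalence classes. A quasi-isometry $f:X\to X$ induces the identity on $\partial X$ if for each Gromov sequence $\{x_i\}$ the sequence $\{f(x_i)\}$ is a Gromov sequence equivalent to $\{x_i\}$. $X$ is boundary rigid if every quasi-isometry $f:X\to X$ inducing the identity on $\partial X$ satisfies $\sup_{x\in X}d(x,f(x))<\infty$. Hyperbolic fillings: a hyperbolic filling of a bounded complete metric space $Z$ is a Gromov hyperbolic space whose Gromov boundary, with a visual metric, is identified with $Z$ via a bilipschitz map. The constructions are as follows. A subset $A$ of $Z$ is $a$-separated if $d(x,y)\ge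 a$ for distinct $x,y\in A$. Graphs are considered with the path metric in which edges have length 1. Bonk–Schramm: $X=Z\times(0,D]$, where $D=\operatorname{diam}Z$ (any fixed $D>0$ if $\operatorname{diam}Z=0$), with metric $\rho((x,s),(y,t))=2\log\frac{d(x,y)+\max\{s,t\}}{\sqrt{st}}$ for distinct points. Bourdon–Pajot: rescale $d$ so that $\operatorname{diam}Z<1$. For each integer $n\ge0$ let $A_n$ be a maximal $e^{-n}$-separated subset of $Z$. $X$ is the graph with vertices the pairs $(x,n)$, $n\ge0$, $x\in A_n$, where distinct vertices $(x,n)$, $(y,m)$ are joined by an edge if $|n-m|\le1$ and $B(x,2e^{-n})\cap B(y,2e^{-m})\ne\emptyset$. Buyalo–Schroeder: fix $0<r\le 1/6$, and let $k_0$ be the largest integer with $\operatorname{diam}Z<r^{k_0}$ ($k_0=0$ if $\operatorname{diam}Z=0$). For each integer $k\ge k_0$ let $V_k$ be a maximal $r^k$-separated subset of $Z$, and for $v\in V_k$ let $B(v)$ be the open ball, and $\bar B(v)$ the closed ball, of radius $2r^k$ centered at $v$. $X$ is the graph whose vertex set is the disjoint union of the $V_k$, $k\ge k_0$; distinct $v,v'\in V_k$ are joined by an edge if $\bar B(v)\cap\bar B(v')\ne\emptyset$; $v\in V_{k+1}$ and $v'\in V_k$ are joined by an edge if $B(v)\subset B(v')$; there are no other edges. *)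

theory Defs
  imports "HOL-Analysis.Analysis"
begin

section \<open>Metric notions\<close>

text \<open>Spaces are carrier sets with a distance function, as in \<^locale>\<open>Metric_space\<close>;
  values of the distance function outside the carrier are irrelevant.\<close>

definition mdiameter :: "'a set \<Rightarrow> ('a \<Rightarrow> 'a \<Rightarrow> real) \<Rightarrow> real" where
  "mdiameter Z d = (SUP (x, y) \<in> Z \<times> Z. d x y)"

definition uniformly_perfect :: "'a set \<Rightarrow> ('a \<Rightarrow> 'a \<Rightarrow> real) \<Rightarrow> bool" where
  "uniformly_perfect Z d \<longleftrightarrow>
     (\<exists>S\<ge>1. \<exists>r0>0. \<forall>x\<in>Z. \<forall>r. 0 < r \<and> r \<le> r0 \<longrightarrow> (\<exists>y\<in>Z. r / S < d x y \<and> d x y \<le> r))"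

definition separated :: "('a \<Rightarrow> 'a \<Rightarrow> real) \<Rightarrow> real \<Rightarrow> 'a set \<Rightarrow> bool" where
  "separated d a A \<longleftrightarrow> (\<forall>x\<in>A. \<forall>y\<in>A. x \<noteq> y \<longrightarrow> a \<le> d x y)"

definition maximal_separated :: "'a set \<Rightarrow> ('a \<Rightarrow> 'a \<Rightarrow> real) \<Rightarrow> real \<Rightarrow> 'a set \<Rightarrow> bool" where
  "maximal_separated Z d a A \<longleftrightarrow>
     A \<subseteq> Z \<and> separated d a A \<and> (\<forall>B. A \<subseteq> B \<and> B \<subseteq> Z \<and> separated d a B \<longrightarrow> B = A)"


section \<open>Quasi-isometries, Gromov sequences and boundary rigidity\<close>

definition quasi_isometry ::
    "'a set \<Rightarrow> ('a \<Rightarrow> 'a \<Rightarrow> real) \<Rightarrow> 'b set \<Rightarrow> ('b \<Rightarrow> 'b \<Rightarrow> real) \<Rightarrow> ('a \<Rightarrow> 'b) \<Rightarrow> bool" where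
  "quasi_isometry X d Y d' f \<longleftrightarrow>
     f \<in> X \<rightarrow> Y \<and>
     (\<exists>K\<ge>1. \<exists>C\<ge>0.
        (\<forall>x\<in>X. \<forall>y\<in>X. d x y / K - C \<le> d' (f x) (f y) \<and> d' (f x) (f y) \<le> K * d x y + C) \<and>
        (\<forall>y\<in>Y. \<exists>x\<in>X. d' y (f x) \<le> C))"

definition gromov_product :: "('a \<Rightarrow> 'a \<Rightarrow> real) \<Rightarrow> 'a \<Rightarrow> 'a \<Rightarrow> 'a \<Rightarrow> real" where
  "gromov_product d w x y = (d x w + d y w - d x y) / 2"

definition gromov_sequence ::
    "'a set \<Rightarrow> ('a \<Rightarrow> 'a \<Rightarrow> real) \<Rightarrow> 'a \<Rightarrow> (nat \<Rightarrow> 'a) \<Rightarrow> bool" where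
  "gromov_sequence X d w x \<longleftrightarrow>
     range x \<subseteq> X \<and>
     filterlim (\<lambda>(i, j). gromov_product d w (x i) (x j)) at_top (sequentially \<times>\<^sub>F sequentially)"

definition gromov_equivalent ::
    "('a \<Rightarrow> 'a \<Rightarrow> real) \<Rightarrow> 'a \<Rightarrow> (nat \<Rightarrow> 'a) \<Rightarrow> (nat \<Rightarrow> 'a) \<Rightarrow> bool" where
  "gromov_equivalent d w x y \<longleftrightarrow>
     filterlim (\<lambda>i. gromov_product d w (x i) (y i)) at_top sequentially"

definition induces_boundary_identity ::
    "'a set \<Rightarrow> ('a \<Rightarrow> 'a \<Rightarrow> real) \<Rightarrow> 'a \<Rightarrow> ('a \<Rightarrow> 'a) \<Rightarrow> bool" where
  "induces_boundary_identity X d w f \<longleftrightarrow>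
     (\<forall>x. gromov_sequence X d w x \<longrightarrow>
        gromov_sequence X d w (f \<circ> x) \<and> gromov_equivalent d w (f \<circ> x) x)"

text \<open>Replacing the base point \<open>w\<close> by \<open>w'\<close> changes Gromov products by at most the distance
  from \<open>w\<close> to \<open>w'\<close>, so the condition below does not depend on \<open>w\<close>.\<close>

definition boundary_rigid :: "'a set \<Rightarrow> ('a \<Rightarrow> 'a \<Rightarrow> real) \<Rightarrow> bool" where
  "boundary_rigid X d \<longleftrightarrow>
     (\<forall>w\<in>X. \<forall>f. quasi_isometry X d X d f \<and> induces_boundary_identity X d w f \<longrightarrow>
        bdd_above ((\<lambda>x. d x (f x)) ` X))"


section \<open>Graphs as path metric spaces\<close>

text \<open>A graph is a vertex set \<open>V\<close> with a symmetric irreflexive adjacency relation \<open>E\<close> on \<open>V\<close>.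
  Its points are given by barycentric coordinates: \<open>edge_point u v t\<close> is the point at
  distance \<open>t\<close> from \<open>u\<close> on the edge of length 1 joining \<open>u\<close> and \<open>v\<close>. Thus
  \<open>edge_point u v t = edge_point v u (1 - t)\<close>, and \<open>edge_point u v 0\<close> is the vertex \<open>u\<close>
  whatever \<open>v\<close> is.\<close>

definition edge_point :: "'v \<Rightarrow> 'v \<Rightarrow> real \<Rightarrow> 'v \<Rightarrow> real" where
  "edge_point u v t = (\<lambda>w. (1 - t) * indicator {u} w + t * indicator {v} w)"

definition graph_points :: "'v set \<Rightarrow> ('v \<Rightarrow> 'v \<Rightarrow> bool) \<Rightarrow> ('v \<Rightarrow> real) set" where
  "graph_points V E =
     {edge_point u v t | u v t. u \<in> V \<and> v \<in> V \<and> (u = v \<or> E u v) \<and> 0 \<le> t \<and> t \<le> 1}"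

text \<open>\<open>pl_path V E p q l\<close>: there is a piecewise linear path of length \<open>l\<close> from \<open>p\<close> to \<open>q\<close>,
  that is, a finite concatenation of segments each contained in a closed edge.\<close>

inductive pl_path ::
    "'v set \<Rightarrow> ('v \<Rightarrow> 'v \<Rightarrow> bool) \<Rightarrow> ('v \<Rightarrow> real) \<Rightarrow> ('v \<Rightarrow> real) \<Rightarrow> real \<Rightarrow> bool"
  for V :: "'v set" and E :: "'v \<Rightarrow> 'v \<Rightarrow> bool" where
  const_path: "p \<in> graph_points V E \<Longrightarrow> pl_path V E p p 0"
| append_segment: "pl_path V E p (edge_point u v s) l \<Longrightarrow> u \<in> V \<Longrightarrow> v \<in> V \<Longrightarrow> E u v \<Longrightarrow>
     s \<in> {0..1} \<Longrightarrow> t \<in> {0..1} \<Longrightarrow> pl_path V E p (edge_point u v t) (l + \<bar>s - t\<bar>)"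

text \<open>This is meaningful only for connected graphs; the graphs below are connected.\<close>

definition graph_dist ::
    "'v set \<Rightarrow> ('v \<Rightarrow> 'v \<Rightarrow> bool) \<Rightarrow> ('v \<Rightarrow> real) \<Rightarrow> ('v \<Rightarrow> real) \<Rightarrow> real" where
  "graph_dist V E p q = Inf {l. pl_path V E p q l}"


section \<open>Hyperbolic fillings\<close>

subsection \<open>Bonk--Schramm\<close>

definition bonk_schramm_height :: "'a set \<Rightarrow> ('a \<Rightarrow> 'a \<Rightarrow> real) \<Rightarrow> real \<Rightarrow> bool" where
  "bonk_schramm_height Z d D \<longleftrightarrow>
     (if mdiameter Z d = 0 then 0 < D else D = mdiameter Z d)"

definition bonk_schramm_points :: "'a set \<Rightarrow> real \<Rightarrow> ('a \<times> real) set" where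
  "bonk_schramm_points Z D = Z \<times> {0<..D}"

definition bonk_schramm_dist ::
    "('a \<Rightarrow> 'a \<Rightarrow> real) \<Rightarrow> 'a \<times> real \<Rightarrow> 'a \<times> real \<Rightarrow> real" where
  "bonk_schramm_dist d = (\<lambda>(x, s) (y, t).
     if (x, s) = (y, t) then 0 else 2 * ln ((d x y + max s t) / sqrt (s * t)))"

subsection \<open>Bourdon--Pajot\<close>

text \<open>Here \<open>d\<close> is the rescaled metric.\<close>

definition bourdon_pajot_nets ::
    "'a set \<Rightarrow> ('a \<Rightarrow> 'a \<Rightarrow> real) \<Rightarrow> (nat \<Rightarrow> 'a set) \<Rightarrow> bool" where
  "bourdon_pajot_nets Z d A \<longleftrightarrow>
     mdiameter Z d < 1 \<and> (\<forall>n. maximal_separated Z d (exp (- real n)) (A n))"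

definition bourdon_pajot_vertices :: "(nat \<Rightarrow> 'a set) \<Rightarrow> ('a \<times> nat) set" where
  "bourdon_pajot_vertices A = {(x, n). x \<in> A n}"

definition bourdon_pajot_edge ::
    "'a set \<Rightarrow> ('a \<Rightarrow> 'a \<Rightarrow> real) \<Rightarrow> 'a \<times> nat \<Rightarrow> 'a \<times> nat \<Rightarrow> bool" where
  "bourdon_pajot_edge Z d = (\<lambda>(x, n) (y, m).
     (x, n) \<noteq> (y, m) \<and> \<bar>int n - int m\<bar> \<le> 1 \<and>
     Metric_space.mball Z d x (2 * exp (- real n)) \<inter>
     Metric_space.mball Z d y (2 * exp (- real m)) \<noteq> {})"

definition bourdon_pajot_points ::
    "'a set \<Rightarrow> ('a \<Rightarrow> 'a \<Rightarrow> real) \<Rightarrow> (nat \<Rightarrow> 'a set) \<Rightarrow> ('a \<times> nat \<Rightarrow> real) set" where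
  "bourdon_pajot_points Z d A =
     graph_points (bourdon_pajot_vertices A) (bourdon_pajot_edge Z d)"

definition bourdon_pajot_dist ::
    "'a set \<Rightarrow> ('a \<Rightarrow> 'a \<Rightarrow> real) \<Rightarrow> (nat \<Rightarrow> 'a set) \<Rightarrow>
     ('a \<times> nat \<Rightarrow> real) \<Rightarrow> ('a \<times> nat \<Rightarrow> real) \<Rightarrow> real" where
  "bourdon_pajot_dist Z d A =
     graph_dist (bourdon_pajot_vertices A) (bourdon_pajot_edge Z d)"

subsection \<open>Buyalo--Schroeder\<close>

definition buyalo_schroeder_nets ::
    "'a set \<Rightarrow> ('a \<Rightarrow> 'a \<Rightarrow> real) \<Rightarrow> real \<Rightarrow> int \<Rightarrow> (int \<Rightarrow> 'a set) \<Rightarrow> bool" where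
  "buyalo_schroeder_nets Z d r k0 V \<longleftrightarrow>
     0 < r \<and> r \<le> 1 / 6 \<and>
     (if mdiameter Z d = 0 then k0 = 0
      else mdiameter Z d < r powi k0 \<and> (\<forall>k. mdiameter Z d < r powi k \<longrightarrow> k \<le> k0)) \<and>
     (\<forall>k\<ge>k0. maximal_separated Z d (r powi k) (V k))"

definition buyalo_schroeder_vertices :: "int \<Rightarrow> (int \<Rightarrow> 'a set) \<Rightarrow> ('a \<times> int) set" where
  "buyalo_schroeder_vertices k0 V = {(v, k). k0 \<le> k \<and> v \<in> V k}"

definition buyalo_schroeder_edge ::
    "'a set \<Rightarrow> ('a \<Rightarrow> 'a \<Rightarrow> real) \<Rightarrow> real \<Rightarrow> 'a \<times> int \<Rightarrow> 'a \<times> int \<Rightarrow> bool" where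
  "buyalo_schroeder_edge Z d r = (\<lambda>(v, k) (v', k').
     k = k' \<and> v \<noteq> v' \<and>
       Metric_space.mcball Z d v (2 * r powi k) \<inter>
       Metric_space.mcball Z d v' (2 * r powi k') \<noteq> {} \<or>
     k = k' + 1 \<and>
       Metric_space.mball Z d v (2 * r powi k) \<subseteq> Metric_space.mball Z d v' (2 * r powi k') \<or>
     k' = k + 1 \<and>
       Metric_space.mball Z d v' (2 * r powi k') \<subseteq> Metric_space.mball Z d v (2 * r powi k))"

definition buyalo_schroeder_points ::
    "'a set \<Rightarrow> ('a \<Rightarrow> 'a \<Rightarrow> real) \<Rightarrow> real \<Rightarrow> int \<Rightarrow> (int \<Rightarrow> 'a set) \<Rightarrow> ('a \<times> int \<Rightarrow> real) set" where
  "buyalo_schroeder_points Z d r k0 V =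
     graph_points (buyalo_schroeder_vertices k0 V) (buyalo_schroeder_edge Z d r)"

definition buyalo_schroeder_dist ::
    "'a set \<Rightarrow> ('a \<Rightarrow> 'a \<Rightarrow> real) \<Rightarrow> real \<Rightarrow> int \<Rightarrow> (int \<Rightarrow> 'a set) \<Rightarrow>
     ('a \<times> int \<Rightarrow> real) \<Rightarrow> ('a \<times> int \<Rightarrow> real) \<Rightarrow> real" where
  "buyalo_schroeder_dist Z d r k0 V =
     graph_dist (buyalo_schroeder_vertices k0 V) (buyalo_schroeder_edge Z d r)"

end

theory Submission
  imports Defs
begin

text \<open>
  All three fillings are, up to scaling and a bounded error, one and the same space: the
  hyperbolic cone \<^term>\<open>bonk_schramm_points Z D\<close> with the metric
  \<open>\<rho> ((x, s), (y, t)) = 2 ln (d x y + max s t) - ln s - ln t\<close>. A rough similarity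
  \<open>\<phi>\<close>, which preserves distances up to a factor and a bounded error, does the same to Gromov products.
  Hence \<open>f \<mapsto> \<phi> \<circ> f \<circ> \<psi>\<close>, with \<open>\<psi>\<close> a rough inverse, transfers boundary rigidity
  (\<open>boundary_rigid_rough_similarity\<close>), and it is enough to treat the cone. In the cone,
  the Gromov product of two points is \<open>- ln (d x y + max s t)\<close> up to a bounded error, so a
  Gromov sequence is one whose points converge in \<open>Z\<close> while their heights tend to zero.

  Let \<open>Z\<close> be uniformly perfect and let \<open>f\<close> be a quasi-isometry of the cone that induces the
  identity on the boundary. Then \<open>f\<close> maps the vertical ray over \<open>x\<close> to a quasi-geodesic
  that starts near the top and converges to \<open>x\<close>. Such a path stays near the ray: the
  projection to the ray contracts exponentially in the distance from the ray, so
  a long excursion would cover distance much faster than it makes progress along the ray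
  (\<open>excursions_bounded\<close>). So, up to a bounded error, \<open>f\<close> moves points along the rays only,
  and what remains is to control the height. Uniform perfectness provides a point \<open>y\<close> with
  \<open>d x y\<close> comparable to \<open>s\<close>. The points \<open>(x, s)\<close> and \<open>(y, s)\<close> are close to each other,
  hence so are their images, which lie near the rays over \<open>x\<close> and \<open>y\<close>. Points near
  these rays are far apart once they are much lower than \<open>d x y\<close>, so \<open>f\<close> cannot lower
  the height by a large factor. The same reasoning with preimages shows that
  it cannot raise it either (\<open>boundary_rigid_of_uniformly_perfect\<close>).

  If \<open>Z\<close> is not uniformly perfect, then there are points \<open>x\<close> whose distances to the other points
  leave arbitrarily long gaps on the logarithmic scale. Over such a gap the cone looks like
  a long segment, along which points may be moved: let \<open>f\<close> raise \<open>(x, s)\<close> by half of the distance from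
  \<open>ln s\<close> to the nearest logarithm of a distance from \<open>x\<close> or of the total height \<open>D\<close>. This is a quasi-isometry inducing the identity
  on the boundary, and it moves the points in the middle of a gap by an amount comparable to the length of the gap
  (\<open>uniformly_perfect_of_boundary_rigid\<close>).

  For the two graphs, a vertex at level \<open>k\<close> with centre \<open>x\<close> corresponds to the point
  \<open>(x, r\<^sup>k)\<close> of the cone, where \<open>r = exp (- 1)\<close> in the case of Bourdon and Pajot. What
  the comparison requires of the edges is collected in the locale \<open>filling_graph\<close>. Going up until the
  centres are within the scale of the level, and then across and down, gives the upper bound for the
  distance of two vertices. For the lower bound, a walk that climbs up to level \<open>j\<close> and has \<open>L\<close> edges to
  spare moves the centre by at most a multiple of \<open>(L + 2) r\<^sup>j\<close> (\<open>walk_dist\<close>); thus \<open>L\<close> spare edges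
  gain only about \<open>2 ln L\<close> in the cone.
\<close>


section \<open>Rough similarities preserve boundary rigidity\<close>

lemma abs_half_diff_le:
  fixes a b c a' b' c' :: real
  assumes "\<bar>a - a'\<bar> \<le> A" "\<bar>b - b'\<bar> \<le> A" "\<bar>c - c'\<bar> \<le> B"
  shows "\<bar>(a + b - c) / 2 - (a' + b' - c') / 2\<bar> \<le> A + B / 2"
  using assms by (auto simp: abs_le_iff field_simps)

locale pseudometric =
  fixes X :: "'a set" and d :: "'a \<Rightarrow> 'a \<Rightarrow> real"
  assumes nonneg: "x \<in> X \<Longrightarrow> y \<in> X \<Longrightarrow> 0 \<le> d x y"
    and refl: "x \<in> X \<Longrightarrow> d x x = 0"
    and sym: "x \<in> X \<Longrightarrow> y \<in> X \<Longrightarrow> d x y = d y x"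
    and tri: "x \<in> X \<Longrightarrow> y \<in> X \<Longrightarrow> z \<in> X \<Longrightarrow> d x z \<le> d x y + d y z"
begin

lemma perturb:
  assumes "x \<in> X" "y \<in> X" "x' \<in> X" "y' \<in> X" "d x x' \<le> a" "d y y' \<le> b"
  shows "\<bar>d x y - d x' y'\<bar> \<le> a + b"
  using tri[of x x' y] tri[of x' y' y] tri[of x' x y'] tri[of x y y'] sym[of x x'] sym[of y y'] assms
  by linarith

lemma gromov_product_perturb:
  assumes "w \<in> X" "x \<in> X" "y \<in> X" "x' \<in> X" "y' \<in> X" "d x x' \<le> C" "d y y' \<le> C"
  shows "\<bar>gromov_product d w x y - gromov_product d w x' y'\<bar> \<le> 2 * C"
proof -
  have "\<bar>d x y - d x' y'\<bar> \<le> C + C" "\<bar>d x w - d x' w\<bar> \<le> C + 0" "\<bar>d y w - d y' w\<bar> \<le> C + 0"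
    by (rule perturb; use assms refl[of w] in simp)+
  from abs_half_diff_le[OF this(2,3,1)] show ?thesis unfolding gromov_product_def by simp
qed

end

lemma quasi_isometryI:
  assumes "\<And>x. x \<in> X \<Longrightarrow> f x \<in> Y" "1 \<le> K" "0 \<le> C"
    and "\<And>x y. x \<in> X \<Longrightarrow> y \<in> X \<Longrightarrow> d x y / K - C \<le> d' (f x) (f y)"
    and "\<And>x y. x \<in> X \<Longrightarrow> y \<in> X \<Longrightarrow> d' (f x) (f y) \<le> K * d x y + C"
    and "\<And>y. y \<in> Y \<Longrightarrow> \<exists>x\<in>X. d' y (f x) \<le> C"
  shows "quasi_isometry X d Y d' f"
  unfolding quasi_isometry_def using assms by (intro conjI exI[of _ K] exI[of _ C]) auto

text \<open>The additive error may be large but the factor is the same for all pairs of points. This is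
  what makes the image of a Gromov product a combination of distances with the same factor, so that Gromov
  products survive up to scaling and a bounded error. Under a quasi-isometry, whose factor may vary with the
  points, their growth can be lost.\<close>

definition rough_similarity ::
    "'a set \<Rightarrow> ('a \<Rightarrow> 'a \<Rightarrow> real) \<Rightarrow> 'b set \<Rightarrow> ('b \<Rightarrow> 'b \<Rightarrow> real) \<Rightarrow> ('a \<Rightarrow> 'b) \<Rightarrow> real \<Rightarrow> real \<Rightarrow> bool" where
  "rough_similarity X d Y d' \<phi> \<mu> C \<longleftrightarrow>
     \<phi> \<in> X \<rightarrow> Y \<and> 0 < \<mu> \<and>
     (\<forall>x\<in>X. \<forall>x'\<in>X. \<bar>d' (\<phi> x) (\<phi> x') - \<mu> * d x x'\<bar> \<le> C) \<and>
     (\<forall>y\<in>Y. \<exists>x\<in>X. d' y (\<phi> x) \<le> C)"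

lemma rough_similarity_gromov_product:
  assumes "rough_similarity X d Y d' \<phi> \<mu> C" "w \<in> X" "x \<in> X" "y \<in> X"
  shows "\<bar>gromov_product d' (\<phi> w) (\<phi> x) (\<phi> y) - \<mu> * gromov_product d w x y\<bar> \<le> 2 * C"
proof -
  have "\<bar>d' (\<phi> x) (\<phi> w) - \<mu> * d x w\<bar> \<le> C" "\<bar>d' (\<phi> y) (\<phi> w) - \<mu> * d y w\<bar> \<le> C"
     "\<bar>d' (\<phi> x) (\<phi> y) - \<mu> * d x y\<bar> \<le> C"
    using assms by (auto simp: rough_similarity_def)
  note this = abs_half_diff_le[OF this]
  moreover have "0 \<le> C" using \<open>\<bar>d' (\<phi> x) (\<phi> w) - \<mu> * d x w\<bar> \<le> C\<close> by linarith
  moreover have "\<mu> * gromov_product d w x y = (\<mu> * d x w + \<mu> * d y w - \<mu> * d x y) / 2"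
    by (simp add: gromov_product_def algebra_simps)
  ultimately show ?thesis unfolding gromov_product_def[of d'] by linarith
qed

lemma filterlim_at_top_affine_bound:
  fixes f g :: "'i \<Rightarrow> real"
  assumes "filterlim f at_top F" "0 < a" "\<And>i. a * f i - b \<le> g i"
  shows "filterlim g at_top F"
proof -
  have "filterlim (\<lambda>i. a * f i) at_top F"
    using assms(1,2) by (simp add: filterlim_tendsto_pos_mult_at_top[OF tendsto_const])
  then have "filterlim (\<lambda>i. - b + a * f i) at_top F"
    by (intro filterlim_tendsto_add_at_top[OF tendsto_const])
  then show ?thesis
    by (rule filterlim_at_top_mono) (use assms(3) in \<open>auto intro!: always_eventually simp: algebra_simps\<close>)
qed

text \<open>Choosing for each \<open>y\<close> a point whose image is close to it gives a rough inverse.\<close>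

lemma rough_similarity_inverse:
  assumes X: "pseudometric X d" and Y: "pseudometric Y d'"
    and \<phi>: "rough_similarity X d Y d' \<phi> \<mu> C"
  obtains \<psi> where "\<psi> \<in> Y \<rightarrow> X" "\<And>y. y \<in> Y \<Longrightarrow> d' y (\<phi> (\<psi> y)) \<le> C"
    "rough_similarity Y d' X d \<psi> (1 / \<mu>) (3 * C / \<mu>)"
proof -
  interpret X: pseudometric X d by fact
  interpret Y: pseudometric Y d' by fact
  have maps: "\<And>x. x \<in> X \<Longrightarrow> \<phi> x \<in> Y" and pos: "0 < \<mu>"
    and sim: "\<And>x x'. x \<in> X \<Longrightarrow> x' \<in> X \<Longrightarrow> \<bar>d' (\<phi> x) (\<phi> x') - \<mu> * d x x'\<bar> \<le> C"
    and onto: "\<forall>y\<in>Y. \<exists>x\<in>X. d' y (\<phi> x) \<le> C"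
    using \<phi> by (auto simp: rough_similarity_def)
  obtain \<psi> where \<psi>: "\<And>y. y \<in> Y \<Longrightarrow> \<psi> y \<in> X" "\<And>y. y \<in> Y \<Longrightarrow> d' y (\<phi> (\<psi> y)) \<le> C"
    using onto by metis
  have s: "\<bar>d (\<psi> y) (\<psi> y') - 1 / \<mu> * d' y y'\<bar> \<le> 3 * C / \<mu>" if "y \<in> Y" "y' \<in> Y" for y y'
  proof -
    have "\<bar>d' y y' - d' (\<phi> (\<psi> y)) (\<phi> (\<psi> y'))\<bar> \<le> C + C"
      using that \<psi> maps by (intro Y.perturb) auto
    then have "\<bar>d' y y' - \<mu> * d (\<psi> y) (\<psi> y')\<bar> \<le> 3 * C"
      using sim[of "\<psi> y" "\<psi> y'"] that \<psi> by fastforce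
    then show ?thesis using pos by (simp add: field_simps abs_le_iff)
  qed
  have o: "d x (\<psi> (\<phi> x)) \<le> 3 * C / \<mu>" if "x \<in> X" for x
  proof -
    have "0 \<le> C" using sim[OF that that] by linarith
    have "\<mu> * d x (\<psi> (\<phi> x)) \<le> 3 * C"
      using sim[of x "\<psi> (\<phi> x)"] \<psi>[of "\<phi> x"] that maps \<open>0 \<le> C\<close> by force
    then show ?thesis using pos by (simp add: field_simps)
  qed
  show thesis
  proof (rule that)
    show "rough_similarity Y d' X d \<psi> (1 / \<mu>) (3 * C / \<mu>)"
      unfolding rough_similarity_def using s o \<psi> maps pos
      by (intro conjI ballI) (auto intro: s, use maps o in blast)
  qed (use \<psi> in auto)
qed

text \<open>The multiplicative constant of \<open>f\<close> survives, since the factors \<open>\<mu>\<close> and \<open>1 / \<mu>\<close> cancel.\<close>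

lemma quasi_isometry_conjugate:
  assumes X: "pseudometric X d" and Y: "pseudometric Y d'"
    and \<phi>: "rough_similarity X d Y d' \<phi> \<mu> C"
    and \<psi>: "rough_similarity Y d' X d \<psi> (1 / \<mu>) (3 * C / \<mu>)"
    and near: "\<And>y. y \<in> Y \<Longrightarrow> d' y (\<phi> (\<psi> y)) \<le> C"
    and f: "quasi_isometry X d X d f"
  shows "quasi_isometry Y d' Y d' (\<phi> \<circ> f \<circ> \<psi>)"
proof (cases "X = {}")
  case True
  then show ?thesis using \<phi> \<psi> by (auto simp: rough_similarity_def quasi_isometry_def intro!: exI[of _ "1::real"])
next
  case False
  interpret X: pseudometric X d by fact
  interpret Y: pseudometric Y d' by fact
  have maps: "\<And>x. x \<in> X \<Longrightarrow> \<phi> x \<in> Y" "\<And>y. y \<in> Y \<Longrightarrow> \<psi> y \<in> X" and pos: "0 < \<mu>"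
    and sim: "\<And>x x'. x \<in> X \<Longrightarrow> x' \<in> X \<Longrightarrow> \<bar>d' (\<phi> x) (\<phi> x') - \<mu> * d x x'\<bar> \<le> C"
    and sim': "\<And>y y'. y \<in> Y \<Longrightarrow> y' \<in> Y \<Longrightarrow> \<bar>d (\<psi> y) (\<psi> y') - 1 / \<mu> * d' y y'\<bar> \<le> 3 * C / \<mu>"
    using \<phi> \<psi> by (auto simp: rough_similarity_def)
  have C: "0 \<le> C" using False sim by fastforce
  obtain K c where K: "K \<ge> 1" "c \<ge> 0" and fm: "\<And>x. x \<in> X \<Longrightarrow> f x \<in> X"
    and fl: "\<And>x y. x \<in> X \<Longrightarrow> y \<in> X \<Longrightarrow> d x y / K - c \<le> d (f x) (f y)"
    and fu: "\<And>x y. x \<in> X \<Longrightarrow> y \<in> X \<Longrightarrow> d (f x) (f y) \<le> K * d x y + c"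
    and fo: "\<And>y. y \<in> X \<Longrightarrow> \<exists>x\<in>X. d y (f x) \<le> c"
    using f unfolding quasi_isometry_def by blast
  define c' where "c' = 5 * K * C + 2 * \<mu> * c + 2 * C"
  have c': "c' \<ge> 0" using K C pos by (simp add: c'_def)
  have sim'': "\<bar>\<mu> * d (\<psi> y) (\<psi> y') - d' y y'\<bar> \<le> 3 * C" if "y \<in> Y" "y' \<in> Y" for y y'
  proof -
    have "\<bar>\<mu> * d (\<psi> y) (\<psi> y') - d' y y'\<bar> = \<mu> * \<bar>d (\<psi> y) (\<psi> y') - 1 / \<mu> * d' y y'\<bar>"
    proof -
      have "\<mu> * d (\<psi> y) (\<psi> y') - d' y y' = \<mu> * (d (\<psi> y) (\<psi> y') - 1 / \<mu> * d' y y')"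
        using pos by (simp add: field_simps)
      then show ?thesis using pos by (simp add: abs_mult)
    qed
    also have "\<dots> \<le> \<mu> * (3 * C / \<mu>)"
      using pos sim'[OF that] by (intro mult_left_mono) auto
    finally show ?thesis using pos by simp
  qed
  have two: "d' y y' / K - c' \<le> d' (\<phi> (f (\<psi> y))) (\<phi> (f (\<psi> y'))) \<and>
        d' (\<phi> (f (\<psi> y))) (\<phi> (f (\<psi> y'))) \<le> K * d' y y' + c'" if y: "y \<in> Y" "y' \<in> Y" for y y'
  proof -
    have 1: "\<bar>d' (\<phi> (f (\<psi> y))) (\<phi> (f (\<psi> y'))) - \<mu> * d (f (\<psi> y)) (f (\<psi> y'))\<bar> \<le> C"
      using y maps fm by (intro sim) auto
    have 2: "\<mu> * d (f (\<psi> y)) (f (\<psi> y')) \<le> \<mu> * (K * d (\<psi> y) (\<psi> y') + c)"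
      using fu y maps pos by (intro mult_left_mono) auto
    have 3: "\<mu> * (d (\<psi> y) (\<psi> y') / K - c) \<le> \<mu> * d (f (\<psi> y)) (f (\<psi> y'))"
      using fl y maps pos by (intro mult_left_mono) auto
    have 4: "K * (\<mu> * d (\<psi> y) (\<psi> y')) \<le> K * (d' y y' + 3 * C)"
      using sim''[OF y] K by (intro mult_left_mono) auto
    have 5: "(d' y y' - 3 * C) / K \<le> \<mu> * d (\<psi> y) (\<psi> y') / K"
      using sim''[OF y] K by (intro divide_right_mono) auto
    have "C / K \<le> C" "C * 1 \<le> C * K" using K C mult_left_mono[of 1 K C] by (auto simp: field_simps)
    then have 6: "C / K \<le> C * K" by linarith
    have 7: "C * K \<ge> 0" "\<mu> * c \<ge> 0" using C K pos by auto
    have "d' y y' / K - 3 * (C / K) \<le> \<mu> * d (\<psi> y) (\<psi> y') / K" using 5 by (simp add: diff_divide_distrib)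
    moreover have "\<mu> * d (\<psi> y) (\<psi> y') / K - \<mu> * c \<le> \<mu> * d (f (\<psi> y)) (f (\<psi> y'))"
      using 3 by (simp add: algebra_simps)
    ultimately have "d' y y' / K - (3 * (C / K) + \<mu> * c + C) \<le> d' (\<phi> (f (\<psi> y))) (\<phi> (f (\<psi> y')))"
      using 1 by linarith
    moreover have "3 * (C / K) + \<mu> * c + C \<le> c'"
    proof -
      have "c' = 5 * (C * K) + 2 * (\<mu> * c) + 2 * C" by (simp add: c'_def)
      then show ?thesis using 6 7 C by linarith
    qed
    ultimately have "d' y y' / K - c' \<le> d' (\<phi> (f (\<psi> y))) (\<phi> (f (\<psi> y')))" by linarith
    moreover have "d' (\<phi> (f (\<psi> y))) (\<phi> (f (\<psi> y'))) \<le> K * d' y y' + c'"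
      unfolding c'_def using 1 2 4 7 C by (simp add: algebra_simps)
    ultimately show ?thesis by blast
  qed
  have "\<exists>y'\<in>Y. d' y (\<phi> (f (\<psi> y'))) \<le> c'" if y: "y \<in> Y" for y
  proof -
    obtain x where x: "x \<in> X" "d (\<psi> y) (f x) \<le> c" using fo maps y by metis
    have "d' y (\<phi> (\<psi> y)) \<le> C" using near y by auto
    moreover have "d' (\<phi> (\<psi> y)) (\<phi> (f x)) \<le> \<mu> * c + C"
    proof -
      have "\<mu> * d (\<psi> y) (f x) \<le> \<mu> * c" using x pos by (intro mult_left_mono) auto
      then show ?thesis using sim[of "\<psi> y" "f x"] x fm maps y by force
    qed
    moreover have "d' (\<phi> (f x)) (\<phi> (f (\<psi> (\<phi> x)))) \<le> K * (2 * C) + \<mu> * c + C"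
    proof -
      have "\<mu> * d x (\<psi> (\<phi> x)) \<le> 2 * C"
        using sim[of x "\<psi> (\<phi> x)"] near[of "\<phi> x"] x maps by force
      then have "K * (\<mu> * d x (\<psi> (\<phi> x))) \<le> K * (2 * C)" using K by (intro mult_left_mono) auto
      moreover have "\<mu> * d (f x) (f (\<psi> (\<phi> x))) \<le> \<mu> * (K * d x (\<psi> (\<phi> x)) + c)"
        using fu x maps pos by (intro mult_left_mono) auto
      moreover have "\<bar>d' (\<phi> (f x)) (\<phi> (f (\<psi> (\<phi> x)))) - \<mu> * d (f x) (f (\<psi> (\<phi> x)))\<bar> \<le> C"
        using x maps fm by (intro sim) auto
      ultimately show ?thesis by (simp add: algebra_simps)
    qed
    moreover have "d' y (\<phi> (f (\<psi> (\<phi> x)))) \<le> d' y (\<phi> (\<psi> y)) + d' (\<phi> (\<psi> y)) (\<phi> (f x)) + d' (\<phi> (f x)) (\<phi> (f (\<psi> (\<phi> x))))"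
      using Y.tri[of y "\<phi> (\<psi> y)" "\<phi> (f x)"] Y.tri[of y "\<phi> (f x)" "\<phi> (f (\<psi> (\<phi> x)))"] x y maps fm by fastforce
    moreover have "C \<le> K * C" using K C mult_right_mono[of 1 K C] by simp
    ultimately have "d' y (\<phi> (f (\<psi> (\<phi> x)))) \<le> c'" unfolding c'_def using C K by (simp add: algebra_simps)
    then show ?thesis using x maps by blast
  qed
  with two show ?thesis
    by (intro quasi_isometryI[of _ _ _ K c']) (use maps fm K c' in auto)
qed

text \<open>A quasi-isometry \<open>f\<close> of \<open>X\<close> becomes \<open>\<phi> \<circ> f \<circ> \<psi>\<close> on \<open>Y\<close>. Gromov products
  change only by the factor \<open>\<mu>\<close> and a bounded error in each of these steps, so the conjugate induces the
  identity on the boundary if \<open>f\<close> does, and a bound for its displacement gives one for the displacement of \<open>f\<close>.\<close>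

lemma boundary_rigid_rough_similarity_imp:
  assumes X: "pseudometric X d" and Y: "pseudometric Y d'"
    and \<phi>: "rough_similarity X d Y d' \<phi> \<mu> C"
    and rigid: "boundary_rigid Y d'"
  shows "boundary_rigid X d"
  unfolding boundary_rigid_def
proof (intro ballI allI impI)
  fix w f
  assume w: "w \<in> X" and "quasi_isometry X d X d f \<and> induces_boundary_identity X d w f"
  then have f: "quasi_isometry X d X d f" and fid: "induces_boundary_identity X d w f" by auto
  interpret X: pseudometric X d by fact
  interpret Y: pseudometric Y d' by fact
  obtain \<psi> where near: "\<And>y. y \<in> Y \<Longrightarrow> d' y (\<phi> (\<psi> y)) \<le> C"
    and \<psi>: "rough_similarity Y d' X d \<psi> (1 / \<mu>) (3 * C / \<mu>)"
    using rough_similarity_inverse[OF X Y \<phi>] by metis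
  have maps: "\<And>x. x \<in> X \<Longrightarrow> \<phi> x \<in> Y" "\<And>y. y \<in> Y \<Longrightarrow> \<psi> y \<in> X" and pos: "0 < \<mu>"
    and sim: "\<And>x x'. x \<in> X \<Longrightarrow> x' \<in> X \<Longrightarrow> \<bar>d' (\<phi> x) (\<phi> x') - \<mu> * d x x'\<bar> \<le> C"
    using \<phi> \<psi> by (auto simp: rough_similarity_def)
  obtain K c where K: "K \<ge> 1" "c \<ge> 0" and fm: "\<And>x. x \<in> X \<Longrightarrow> f x \<in> X"
    and fu: "\<And>x y. x \<in> X \<Longrightarrow> y \<in> X \<Longrightarrow> d (f x) (f y) \<le> K * d x y + c"
    using f unfolding quasi_isometry_def by blast
  note gp = rough_similarity_gromov_product[OF \<phi> w]
  have "induces_boundary_identity Y d' (\<phi> w) (\<phi> \<circ> f \<circ> \<psi>)"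
    unfolding induces_boundary_identity_def
  proof (intro allI impI)
    fix q assume "gromov_sequence Y d' (\<phi> w) q"
    then have qY: "\<And>i. q i \<in> Y"
      and q: "filterlim (\<lambda>(i, j). gromov_product d' (\<phi> w) (q i) (q j)) at_top (sequentially \<times>\<^sub>F sequentially)"
      by (auto simp: gromov_sequence_def)
    have e: "\<bar>gromov_product d' (\<phi> w) (q i) (q j) - gromov_product d' (\<phi> w) (\<phi> (\<psi> (q i))) (\<phi> (\<psi> (q j)))\<bar> \<le> 2 * C"
      for i j by (rule Y.gromov_product_perturb) (use w qY maps near in auto)
    have "filterlim (\<lambda>ij. gromov_product d w (\<psi> (q (fst ij))) (\<psi> (q (snd ij)))) at_top (sequentially \<times>\<^sub>F sequentially)"
    proof (rule filterlim_at_top_affine_bound[OF q, of "1 / \<mu>" "4 * C / \<mu>"])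
      fix ij :: "nat \<times> nat"
      obtain i j where ij: "ij = (i, j)" by fastforce
      show "1 / \<mu> * (case ij of (i, j) \<Rightarrow> gromov_product d' (\<phi> w) (q i) (q j)) - 4 * C / \<mu>
         \<le> gromov_product d w (\<psi> (q (fst ij))) (\<psi> (q (snd ij)))"
        using e[of i j] gp[of "\<psi> (q i)" "\<psi> (q j)"] maps(2)[OF qY[of i]] maps(2)[OF qY[of j]] pos
        unfolding ij by (simp add: field_simps abs_le_iff)
    qed (use pos in auto)
    then have "gromov_sequence X d w (\<psi> \<circ> q)"
      using qY maps by (auto simp: gromov_sequence_def case_prod_unfold)
    then have fg: "gromov_sequence X d w (f \<circ> (\<psi> \<circ> q))" and fe: "gromov_equivalent d w (f \<circ> (\<psi> \<circ> q)) (\<psi> \<circ> q)"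
      using fid by (auto simp: induces_boundary_identity_def)
    have inX: "\<And>i. f (\<psi> (q i)) \<in> X" using fm maps qY by auto
    have "filterlim (\<lambda>ij. gromov_product d' (\<phi> w) (\<phi> (f (\<psi> (q (fst ij))))) (\<phi> (f (\<psi> (q (snd ij)))))) at_top (sequentially \<times>\<^sub>F sequentially)"
    proof (rule filterlim_at_top_affine_bound)
      show "filterlim (\<lambda>(i, j). gromov_product d w (f (\<psi> (q i))) (f (\<psi> (q j)))) at_top (sequentially \<times>\<^sub>F sequentially)"
        using fg by (simp add: gromov_sequence_def)
      show "\<mu> * (case ij of (i, j) \<Rightarrow> gromov_product d w (f (\<psi> (q i))) (f (\<psi> (q j)))) - 2 * C
        \<le> gromov_product d' (\<phi> w) (\<phi> (f (\<psi> (q (fst ij))))) (\<phi> (f (\<psi> (q (snd ij)))))" for ij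
        using gp[OF inX[of "fst ij"] inX[of "snd ij"]] by (simp add: case_prod_unfold abs_le_iff)
    qed (use pos in auto)
    then have 1: "gromov_sequence Y d' (\<phi> w) (\<phi> \<circ> f \<circ> \<psi> \<circ> q)"
      using inX maps by (auto simp: gromov_sequence_def case_prod_unfold)
    have "filterlim (\<lambda>i. gromov_product d' (\<phi> w) (\<phi> (f (\<psi> (q i)))) (q i)) at_top sequentially"
    proof (rule filterlim_at_top_affine_bound)
      show "filterlim (\<lambda>i. gromov_product d w (f (\<psi> (q i))) (\<psi> (q i))) at_top sequentially"
        using fe by (simp add: gromov_equivalent_def)
      have *: "\<bar>gromov_product d' (\<phi> w) (\<phi> (f (\<psi> (q i)))) (q i) - gromov_product d' (\<phi> w) (\<phi> (f (\<psi> (q i)))) (\<phi> (\<psi> (q i)))\<bar> \<le> 2 * C" for i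
        using near[OF qY[of i]] Y.refl Y.nonneg[OF qY[of i], of "\<phi> (\<psi> (q i))"]
        by (intro Y.gromov_product_perturb) (use w inX qY maps in auto)
      show "\<mu> * gromov_product d w (f (\<psi> (q i))) (\<psi> (q i)) - 4 * C \<le> gromov_product d' (\<phi> w) (\<phi> (f (\<psi> (q i)))) (q i)" for i
        unfolding abs_le_iff using *[of i, THEN abs_le_D2] gp[OF inX[of i] maps(2)[OF qY[of i]], THEN abs_le_D2] by linarith
    qed (use pos in auto)
    with 1 show "gromov_sequence Y d' (\<phi> w) (\<phi> \<circ> f \<circ> \<psi> \<circ> q) \<and> gromov_equivalent d' (\<phi> w) (\<phi> \<circ> f \<circ> \<psi> \<circ> q) q"
      by (simp add: gromov_equivalent_def)
  qed
  moreover have "quasi_isometry Y d' Y d' (\<phi> \<circ> f \<circ> \<psi>)"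
    by (rule quasi_isometry_conjugate[OF X Y \<phi> \<psi> near f])
  ultimately have "bdd_above ((\<lambda>y. d' y ((\<phi> \<circ> f \<circ> \<psi>) y)) ` Y)"
    using rigid[unfolded boundary_rigid_def, rule_format, OF maps(1)[OF w], of "\<phi> \<circ> f \<circ> \<psi>"] by simp
  then obtain B where B: "\<And>y. y \<in> Y \<Longrightarrow> d' y (\<phi> (f (\<psi> y))) \<le> B"
    by (auto simp: bdd_above_def)
  have "d x (f x) \<le> 2 * C / \<mu> + (2 * C + B) / \<mu> + (K * (2 * C / \<mu>) + c)" if x: "x \<in> X" for x
  proof -
    let ?x = "\<psi> (\<phi> x)"
    have m: "?x \<in> X" "f x \<in> X" "f ?x \<in> X" "\<phi> x \<in> Y" "\<phi> ?x \<in> Y" "\<phi> (f ?x) \<in> Y" using x maps fm by auto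
    have "\<mu> * d x ?x \<le> 2 * C" using sim[OF x m(1)] near[OF m(4)] by linarith
    then have 1: "d x ?x \<le> 2 * C / \<mu>" using pos by (simp add: field_simps)
    have "d' (\<phi> ?x) (\<phi> (f ?x)) \<le> C + B"
      using Y.tri[OF m(5,4,6)] Y.sym[OF m(4,5)] near[OF m(4)] B[OF m(4)] by linarith
    then have "\<mu> * d ?x (f ?x) \<le> 2 * C + B" using sim[OF m(1,3)] by linarith
    then have 2: "d ?x (f ?x) \<le> (2 * C + B) / \<mu>" using pos by (simp add: field_simps)
    have "K * d ?x x \<le> K * (2 * C / \<mu>)" using 1 K X.sym[OF x m(1)] by (intro mult_left_mono) auto
    then have 3: "d (f ?x) (f x) \<le> K * (2 * C / \<mu>) + c" using fu[OF m(1) x] by linarith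
    show ?thesis using 1 2 3 X.tri[OF x m(1,2)] X.tri[OF m(1,3,2)] by linarith
  qed
  then show "bdd_above ((\<lambda>x. d x (f x)) ` X)" by (rule bdd_aboveI2)
qed

lemma boundary_rigid_rough_similarity:
  assumes X: "pseudometric X d" and Y: "pseudometric Y d'"
    and \<phi>: "rough_similarity X d Y d' \<phi> \<mu> C"
  shows "boundary_rigid X d \<longleftrightarrow> boundary_rigid Y d'"
  using rough_similarity_inverse[OF X Y \<phi>] boundary_rigid_rough_similarity_imp[OF Y X]
    boundary_rigid_rough_similarity_imp[OF X Y \<phi>] by metis


section \<open>Excursions of quasi-geodesics\<close>

lemma telescoping_bound:
  fixes \<alpha> :: "nat \<Rightarrow> real"
  assumes "a \<le> b" "\<And>n. a \<le> n \<Longrightarrow> n < b \<Longrightarrow> \<bar>\<alpha> (Suc n) - \<alpha> n\<bar> \<le> e n"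
  shows "\<bar>\<alpha> b - \<alpha> a\<bar> \<le> sum e {a..<b}"
proof -
  have "\<bar>\<alpha> b - \<alpha> a\<bar> = \<bar>\<Sum>n=a..<b. \<alpha> (Suc n) - \<alpha> n\<bar>" using assms(1) by (simp add: sum_Suc_diff')
  also have "\<dots> \<le> (\<Sum>n=a..<b. e n)" using assms(2) by (intro order.trans[OF sum_abs] sum_mono) auto
  finally show ?thesis .
qed

text \<open>This is the stability of quasi-geodesics, reduced to two sequences. Think of
  \<open>\<delta> n\<close> as the distance from the \<open>n\<close>-th point of a path to a vertical ray, and of \<open>\<alpha> n\<close> as the
  position on the ray of the projection of that point. The first condition says that the path is a quasi-geodesic,
  where distances are bounded by going to the ray, along it and back; the second says that the projection contracts
  exponentially in the distance from the ray; the last says that the path converges to the end of the ray.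

  At distance \<open>R\<close> the projection moves by at most \<open>1 / (2 * K)\<close> per step, half of the speed that the
  path must have. So during an excursion beyond \<open>R\<close> the distance from the ray grows linearly. If
  the path returns, this bounds the length of the excursion, and with it \<open>\<delta>\<close>. If it never returns, the steps of the
  projection are summable, and the projection cannot run off to the end of the ray.\<close>

lemma excursions_bounded:
  fixes K C A \<Delta> :: real
  assumes "K \<ge> 1" "C \<ge> 0" "A \<ge> 0"
  shows "\<exists>R. \<forall>\<alpha> \<delta> :: nat \<Rightarrow> real.
    (\<forall>n m. \<bar>real n - real m\<bar> / K - C \<le> \<bar>\<alpha> n - \<alpha> m\<bar> + \<delta> n + \<delta> m) \<longrightarrow>
    (\<forall>n. \<bar>\<alpha> (Suc n) - \<alpha> n\<bar> \<le> A * max (exp (- \<delta> n)) (exp (- \<delta> (Suc n)))) \<longrightarrow>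
    (\<forall>n. \<bar>\<delta> (Suc n) - \<delta> n\<bar> \<le> A) \<longrightarrow>
    \<delta> 0 \<le> \<Delta> \<longrightarrow> (\<forall>B. \<exists>n. \<alpha> n < B) \<longrightarrow> (\<forall>n. \<delta> n \<le> R)"
proof -
  define R where "R = max \<Delta> (ln (2 * K * (A + 1)))"
  have expR: "A * exp (- R) \<le> 1 / (2 * K)"
  proof -
    have pos: "0 < 2 * K * (A + 1)" using assms by (intro mult_pos_pos) auto
    have "exp (- R) \<le> exp (- ln (2 * K * (A + 1)))" by (simp add: R_def)
    also have "\<dots> = 1 / (2 * K * (A + 1))" using pos by (simp only: exp_minus exp_ln inverse_eq_divide)
    finally have "A * exp (- R) \<le> A * (1 / (2 * K * (A + 1)))" using assms by (intro mult_left_mono)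
    also have "\<dots> = 1 / (2 * K) * (A / (A + 1))" by simp
    also have "\<dots> \<le> 1 / (2 * K) * 1" using assms by (intro mult_left_mono) auto
    also have "\<dots> = 1 / (2 * K)" by simp
    finally show ?thesis .
  qed
  define T where "T = 2 * K * (C + 2 * R + 2 * A)"
  show ?thesis
  proof (intro exI[of _ "max R (R + A + A * T)"] allI impI)
    fix \<alpha> \<delta> :: "nat \<Rightarrow> real" and N :: nat
    assume "\<forall>n m. \<bar>real n - real m\<bar> / K - C \<le> \<bar>\<alpha> n - \<alpha> m\<bar> + \<delta> n + \<delta> m"
    then have qi: "\<bar>real n - real m\<bar> / K - C \<le> \<bar>\<alpha> n - \<alpha> m\<bar> + \<delta> n + \<delta> m" for n m by blast
    assume "\<forall>n. \<bar>\<alpha> (Suc n) - \<alpha> n\<bar> \<le> A * max (exp (- \<delta> n)) (exp (- \<delta> (Suc n)))"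
    then have step: "\<bar>\<alpha> (Suc n) - \<alpha> n\<bar> \<le> A * max (exp (- \<delta> n)) (exp (- \<delta> (Suc n)))" for n by blast
    assume "\<forall>n. \<bar>\<delta> (Suc n) - \<delta> n\<bar> \<le> A"
    then have dstep: "\<bar>\<delta> (Suc n) - \<delta> n\<bar> \<le> A" for n by blast
    assume init: "\<delta> 0 \<le> \<Delta>" and "\<forall>B. \<exists>n. \<alpha> n < B"
    then have unb: "\<exists>n. \<alpha> n < B" for B by blast
    show "\<delta> N \<le> max R (R + A + A * T)"
    proof (cases "\<delta> N \<le> R")
      case False
      \<comment> \<open>The excursion containing \<open>N\<close> starts after \<open>a\<close>, which exists because \<open>\<delta> 0 \<le> \<Delta> \<le> R\<close>.\<close>
      define a where "a = (GREATEST n. n \<le> N \<and> \<delta> n \<le> R)"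
      have a: "a \<le> N \<and> \<delta> a \<le> R" unfolding a_def
        by (rule GreatestI_nat[of _ 0 N]) (use init in \<open>auto simp: R_def\<close>)
      have above: "\<delta> n > R" if "a < n" "n \<le> N" for n
        using Greatest_le_nat[of "\<lambda>n. n \<le> N \<and> \<delta> n \<le> R" n N] that a_def by fastforce
      define a' where "a' = Suc a"
      have a'N: "a' \<le> N" using a False a'_def by (cases "a = N") auto
      have da': "\<delta> a' \<le> R + A" using dstep[of a] a unfolding a'_def by linarith
      \<comment> \<open>Along the excursion the projection supplies only half of the distance that the path covers.\<close>
      have grow: "real (b - a') / (2 * K) - C - R - A \<le> \<delta> b"
        if b: "a' \<le> b" and ab: "\<And>n. a' \<le> n \<Longrightarrow> n \<le> b \<Longrightarrow> \<delta> n > R" for b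
      proof -
        have "\<bar>\<alpha> b - \<alpha> a'\<bar> \<le> (\<Sum>n=a'..<b. 1 / (2 * K))"
        proof (rule telescoping_bound[OF b])
          fix n assume n: "a' \<le> n" "n < b"
          have "max (exp (- \<delta> n)) (exp (- \<delta> (Suc n))) \<le> exp (- R)"
            using ab[of n] ab[of "Suc n"] n by auto
          from mult_left_mono[OF this \<open>A \<ge> 0\<close>] show "\<bar>\<alpha> (Suc n) - \<alpha> n\<bar> \<le> 1 / (2 * K)"
            using step[of n] expR by linarith
        qed
        then have "\<bar>\<alpha> b - \<alpha> a'\<bar> \<le> real (b - a') / (2 * K)" by simp
        moreover have "real (b - a') / K - C \<le> \<bar>\<alpha> b - \<alpha> a'\<bar> + \<delta> b + \<delta> a'"
          using qi[of b a'] b by (simp add: of_nat_diff)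
        moreover have "real (b - a') / K = 2 * (real (b - a') / (2 * K))" using assms by simp
        ultimately show ?thesis using da' by linarith
      qed
      show ?thesis
      proof (cases "\<exists>n>N. \<delta> n \<le> R")
        case True
        define b' where "b' = (LEAST n. n > N \<and> \<delta> n \<le> R)"
        have b': "b' > N \<and> \<delta> b' \<le> R" 
          unfolding b'_def by (rule LeastI_ex) (use True in blast)
        obtain b where b: "b' = Suc b" using b' by (cases b') simp_all
        have ab: "\<delta> n > R" if "a' \<le> n" "n \<le> b" for n
        proof (cases "n \<le> N")
          case False
          have "n < (LEAST n. n > N \<and> \<delta> n \<le> R)" using that b b'_def by linarith
          from not_less_Least[OF this] False show ?thesis by auto
        qed (use above[of n] that a'_def in auto)
        have "\<delta> b \<le> R + A" using dstep[of b] b' unfolding b by linarith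
        moreover have "real (b - a') / (2 * K) - C - R - A \<le> \<delta> b" using a'N b b' ab by (intro grow) auto
        ultimately have "real (b - a') / (2 * K) \<le> C + 2 * R + 2 * A" by linarith
        then have "real (b - a') \<le> T" using assms by (simp add: T_def field_simps)
        then have T: "real (N - a') \<le> T" using b b' by linarith
        have "\<bar>\<delta> N - \<delta> a'\<bar> \<le> (\<Sum>n=a'..<N. A)" by (rule telescoping_bound[OF a'N]) (rule dstep)
        also have "\<dots> = A * real (N - a')" by simp
        also have "\<dots> \<le> A * T" using T assms by (intro mult_left_mono) auto
        finally show ?thesis using da' by linarith
      next
        case never: False
        have ab: "\<delta> n > R" if "a' \<le> n" for n
          using above[of n] never that a'_def by (cases "n \<le> N") (auto simp: not_le)
        define q where "q = exp (- (1 / (2 * K)))"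
        have q: "0 < q" "q < 1" using assms by (auto simp: q_def)
        define E where "E = A * exp (C + R + A)"
        have E: "E \<ge> 0" using assms by (simp add: E_def)
        have st: "\<bar>\<alpha> (Suc (a' + i)) - \<alpha> (a' + i)\<bar> \<le> E * q ^ i" for i
        proof -
          have d: "exp (- \<delta> (a' + k)) \<le> exp (C + R + A) * q ^ k" for k
          proof -
            have "real k / (2 * K) - C - R - A \<le> \<delta> (a' + k)" using grow[of "a' + k"] ab by simp
            then have "exp (- \<delta> (a' + k)) \<le> exp ((C + R + A) + real k * (- (1 / (2 * K))))" by simp
            also have "\<dots> = exp (C + R + A) * q ^ k" unfolding q_def exp_add exp_of_nat_mult ..
            finally show ?thesis .
          qed
          have "q ^ Suc i \<le> q ^ i" using q by (intro power_decreasing) auto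
          then have "exp (C + R + A) * q ^ Suc i \<le> exp (C + R + A) * q ^ i"
            by (intro mult_left_mono) auto
          then have "exp (- \<delta> (a' + Suc i)) \<le> exp (C + R + A) * q ^ i"
            using d[of "Suc i"] by linarith
          then have "max (exp (- \<delta> (a' + i))) (exp (- \<delta> (Suc (a' + i)))) \<le> exp (C + R + A) * q ^ i"
            using d[of i] by simp
          from mult_left_mono[OF this \<open>A \<ge> 0\<close>] show ?thesis
            using step[of "a' + i"] by (simp add: E_def algebra_simps)
        qed
        have tail: "\<alpha> a' - E / (1 - q) \<le> \<alpha> n" if "a' \<le> n" for n
        proof -
          obtain k where k: "n = a' + k" using \<open>a' \<le> n\<close> le_Suc_ex by blast
          have "\<bar>\<alpha> (a' + k) - \<alpha> (a' + 0)\<bar> \<le> (\<Sum>i=0..<k. E * q ^ i)"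
            by (rule telescoping_bound[of 0 k "\<lambda>i. \<alpha> (a' + i)"]) (use st in auto)
          also have "\<dots> = E * (\<Sum>i<k. q ^ i)" by (simp add: sum_distrib_left atLeast0LessThan)
          also have "\<dots> \<le> E * (1 / (1 - q))"
          proof -
            have "(\<Sum>i<k. q ^ i) = (1 - q ^ k) / (1 - q)" using q sum_gp_strict[of q k] by simp
            also have "\<dots> \<le> 1 / (1 - q)" using q by (intro divide_right_mono) auto
            finally show ?thesis using E by (intro mult_left_mono)
          qed
          finally show ?thesis using k by simp
        qed
        define B where "B = min (\<alpha> a' - E / (1 - q)) (Min (\<alpha> ` {..a'}))"
        obtain n where n: "\<alpha> n < B" using unb by blast
        then have "\<not> a' \<le> n" using tail[of n] by (auto simp: B_def)
        then have "Min (\<alpha> ` {..a'}) \<le> \<alpha> n" by (intro Min_le) auto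
        moreover have "B \<le> Min (\<alpha> ` {..a'})" by (simp add: B_def)
        ultimately show ?thesis using n by linarith
      qed
    qed auto
  qed
qed


section \<open>Cones over uniformly perfect spaces are boundary rigid\<close>

text \<open>Passing from a radius \<open>s\<close> to \<open>s / c\<close>, with \<open>c\<close> at least \<open>D / r0\<close>, costs a factor \<open>c\<close> in the constant.\<close>

lemma uniformly_perfect_up_to:
  assumes "uniformly_perfect Z d" "0 < D"
  obtains S where "1 \<le> S" "\<And>x s. x \<in> Z \<Longrightarrow> 0 < s \<Longrightarrow> s \<le> D \<Longrightarrow> \<exists>y\<in>Z. s / S < d x y \<and> d x y \<le> s"
proof -
  obtain S r0 where S: "1 \<le> S" "0 < r0"
    and up: "\<And>x r. x \<in> Z \<Longrightarrow> 0 < r \<Longrightarrow> r \<le> r0 \<Longrightarrow> \<exists>y\<in>Z. r / S < d x y \<and> d x y \<le> r"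
    using assms(1) unfolding uniformly_perfect_def by blast
  define c where "c = max 1 (D / r0)"
  have c: "1 \<le> c" "D / r0 \<le> c" by (auto simp: c_def)
  show thesis
  proof (rule that[of "S * c"])
    show "1 \<le> S * c" using S c mult_mono[of 1 S 1 c] by simp
    fix x s assume x: "x \<in> Z" and s: "0 < s" "s \<le> D"
    have "s / c \<le> r0"
    proof -
      have "s \<le> D / r0 * r0" using s S by simp
      also have "\<dots> \<le> c * r0" using c S by (intro mult_right_mono) auto
      finally show ?thesis using c by (simp add: field_simps)
    qed
    then obtain y where y: "y \<in> Z" "s / c / S < d x y" "d x y \<le> s / c"
      using up[OF x, of "s / c"] s c by force
    moreover have "s / c \<le> s / 1" using s c by (intro divide_left_mono) auto
    ultimately show "\<exists>y\<in>Z. s / (S * c) < d x y \<and> d x y \<le> s"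
      by (intro bexI[of _ y]) (auto simp: mult.commute)
  qed
qed

text \<open>The height bound \<open>D\<close> is any bound for the distances, so that one locale covers all three fillings.\<close>

locale hyperbolic_cone = Metric_space Z d for Z :: "'a set" and d +
  fixes D :: real
  assumes D_pos: "0 < D" and dist_le: "\<And>x y. x \<in> Z \<Longrightarrow> y \<in> Z \<Longrightarrow> d x y \<le> D" and nonempty: "Z \<noteq> {}"
begin

abbreviation "Y \<equiv> bonk_schramm_points Z D"
abbreviation "\<rho> \<equiv> bonk_schramm_dist d"

lemma pos_dist_add [simp]: "0 < s \<Longrightarrow> 0 < d x y + s"
  using nonneg[of x y] by linarith

lemma mem_Y: "(x, s) \<in> Y \<longleftrightarrow> x \<in> Z \<and> 0 < s \<and> s \<le> D"
  by (auto simp: bonk_schramm_points_def)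

lemma \<rho>_eq:
  assumes "x \<in> Z" "0 < s" "0 < t"
  shows "\<rho> (x, s) (y, t) = 2 * ln (d x y + max s t) - ln s - ln t"
proof (cases "(x, s) = (y, t)")
  case True
  then show ?thesis using assms by (simp add: bonk_schramm_dist_def)
next
  case False
  have "0 < d x y + max s t" using assms by (intro pos_dist_add) auto
  then have "d x y + max s t \<noteq> 0" by linarith
  then have "ln ((d x y + max s t) / sqrt (s * t)) = ln (d x y + max s t) - (ln s + ln t) / 2"
    using assms by (subst ln_div) (auto simp: ln_sqrt ln_mult)
  moreover have "\<rho> (x, s) (y, t) = 2 * ln ((d x y + max s t) / sqrt (s * t))"
    using False by (auto simp: bonk_schramm_dist_def)
  ultimately show ?thesis by (simp add: field_simps)
qed

lemma \<rho>_vertical: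
  assumes "x \<in> Z" "0 < s" "0 < t"
  shows "\<rho> (x, s) (x, t) = \<bar>ln s - ln t\<bar>"
  using assms by (cases "s \<le> t") (auto simp: \<rho>_eq max_def)

text \<open>The triangle inequality exponentiates to
  \<open>(d x z + max s u) * t \<le> (d x y + max s t) * (d y z + max t u)\<close>.\<close>

lemma pseudometric_Y: "pseudometric Y \<rho>"
proof
  fix p q r assume pqr: "p \<in> Y" "q \<in> Y" "r \<in> Y"
  obtain x s y t z u where eq: "p = (x, s)" "q = (y, t)" "r = (z, u)" by (metis surj_pair)
  have h: "x \<in> Z" "y \<in> Z" "z \<in> Z" "0 < s" "0 < t" "0 < u" using pqr by (auto simp: eq mem_Y)
  let ?a = "d x z + max s u" and ?b = "d x y + max s t" and ?c = "d y z + max t u"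
  have pos: "0 < ?a" "0 < ?b" "0 < ?c" using h by (auto intro!: pos_dist_add simp: less_max_iff_disj)
  have "?a * t \<le> d x y * t + d y z * t + max s u * t"
    using triangle[OF h(1-3)] h by (simp add: distrib_right[symmetric])
  also have "\<dots> \<le> d x y * max t u + d y z * max s t + max s t * max t u"
  proof (intro add_mono mult_left_mono)
    show "max s u * t \<le> max s t * max t u"
    proof (cases "s \<le> u")
      case True
      then show ?thesis using h mult_mono[of t "max s t" u "max t u"] by (simp add: mult.commute max_def)
    next
      case False
      then show ?thesis using h mult_mono[of s "max s t" t "max t u"] by (simp add: max_def)
    qed
  qed (use nonneg in auto)
  also have "\<dots> \<le> ?b * ?c" using nonneg[of x y] nonneg[of y z] by (simp add: algebra_simps)
  finally have "ln (?a * t) \<le> ln (?b * ?c)" using pos h by simp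
  then show "\<rho> p r \<le> \<rho> p q + \<rho> q r" using pos h by (simp add: eq \<rho>_eq ln_mult)
next
  fix p q assume "p \<in> Y" "q \<in> Y"
  moreover obtain x s y t where eq: "p = (x, s)" "q = (y, t)" by (metis surj_pair)
  ultimately have h: "x \<in> Z" "y \<in> Z" "0 < s" "0 < t" by (auto simp: mem_Y)
  have "ln s \<le> ln (d x y + max s t)" "ln t \<le> ln (d x y + max s t)"
    using h by (auto intro!: ln_mono add_increasing)
  then have "0 \<le> 2 * ln (d x y + max s t) - ln s - ln t" by linarith
  then show "0 \<le> \<rho> p q" using h by (simp only: eq \<rho>_eq)
  show "\<rho> p q = \<rho> q p" using h by (simp add: eq \<rho>_eq commute max.commute)
next
  fix p assume "p \<in> Y"
  then show "\<rho> p p = 0" by (simp add: bonk_schramm_dist_def split: prod.splits)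
qed

sublocale Y: pseudometric Y \<rho> by (rule pseudometric_Y)

text \<open>Up to a bounded error, the height at which the vertical rays through two points meet, on the
  logarithmic scale, and the negative of their Gromov product.\<close>

definition log_size :: "'a \<times> real \<Rightarrow> 'a \<times> real \<Rightarrow> real" where
  "log_size p q = ln (d (fst p) (fst q) + max (snd p) (snd q))"

lemma gromov_product_log_size:
  assumes "w \<in> Y"
  obtains B where "\<And>p q. p \<in> Y \<Longrightarrow> q \<in> Y \<Longrightarrow> \<bar>gromov_product \<rho> w p q + log_size p q\<bar> \<le> B"
proof -
  obtain w0 \<tau> where w: "w = (w0, \<tau>)" by fastforce
  have h: "w0 \<in> Z" "0 < \<tau>" "\<tau> \<le> D" using assms by (auto simp: w mem_Y)
  have bd: "ln \<tau> \<le> log_size p w \<and> log_size p w \<le> ln (2 * D)" if "p \<in> Y" for p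
  proof -
    have m: "fst p \<in> Z" "0 < snd p" "snd p \<le> D" using that by (cases p; auto simp: mem_Y)+
    have "\<tau> \<le> d (fst p) w0 + max (snd p) \<tau>" using nonneg[of "fst p" w0] by linarith
    moreover have "d (fst p) w0 + max (snd p) \<tau> \<le> 2 * D" using dist_le[OF m(1) h(1)] m h by auto
    ultimately show ?thesis using h by (auto simp: log_size_def w intro!: ln_mono)
  qed
  show thesis
  proof (rule that)
    fix p q assume pq: "p \<in> Y" "q \<in> Y"
    have "gromov_product \<rho> w p q + log_size p q = log_size p w + log_size q w - ln \<tau>"
      using pq h by (cases p; cases q) (simp add: gromov_product_def w \<rho>_eq mem_Y log_size_def field_simps)
    then show "\<bar>gromov_product \<rho> w p q + log_size p q\<bar> \<le> 2 * \<bar>ln (2 * D)\<bar> + 3 * \<bar>ln \<tau>\<bar>"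
      using bd[OF pq(1)] bd[OF pq(2)] by linarith
  qed
qed

text \<open>The vertical ray through \<open>(y, u)\<close> and the one over \<open>x\<close> come close to each other at height
  \<open>d x y + u\<close>. So \<open>reach x p\<close> is, on the logarithmic scale, the height of the projection
  of \<open>p\<close> to the ray over \<open>x\<close>, and \<open>depth x p\<close> below is the distance of \<open>p\<close> from this ray.\<close>

definition reach :: "'a \<Rightarrow> 'a \<times> real \<Rightarrow> real" where
  "reach x p = ln (d x (fst p) + snd p)"

definition depth :: "'a \<Rightarrow> 'a \<times> real \<Rightarrow> real" where
  "depth x p = reach x p - ln (snd p)"

lemma
  assumes "x \<in> Z" "p \<in> Y"
  shows depth_nonneg: "0 \<le> depth x p" and reach_ge: "ln (snd p) \<le> reach x p" and reach_le: "reach x p \<le> ln (2 * D)"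
proof -
  have m: "fst p \<in> Z" "0 < snd p" "snd p \<le> D" using assms by (cases p; auto simp: mem_Y)+
  show 1: "ln (snd p) \<le> reach x p" using m nonneg[of x "fst p"] by (auto simp: reach_def intro!: ln_mono)
  then show "0 \<le> depth x p" by (simp add: depth_def)
  show "reach x p \<le> ln (2 * D)"
    using m nonneg[of x "fst p"] dist_le[OF assms(1) m(1)] unfolding reach_def by (intro ln_mono pos_dist_add) auto
qed

text \<open>Go up from \<open>p\<close> to the ray over \<open>x\<close>, along the ray, and down to \<open>q\<close>.\<close>

lemma \<rho>_le_reach_depth:
  assumes "x \<in> Z" "p \<in> Y" "q \<in> Y"
  shows "\<rho> p q \<le> 2 * ln 2 + \<bar>reach x p - reach x q\<bar> + depth x p + depth x q"
proof -
  obtain y u z v where eq: "p = (y, u)" "q = (z, v)" by (metis surj_pair)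
  have h: "y \<in> Z" "z \<in> Z" "0 < u" "0 < v" using assms by (auto simp: eq mem_Y)
  let ?a = "d x y + u" and ?b = "d x z + v"
  have pos: "0 < ?a" "0 < ?b" using h by auto
  have "d y z + max u v \<le> 2 * max ?a ?b"
    using triangle[OF h(1) assms(1) h(2)] commute[of x y] h(3,4) nonneg[of x y] nonneg[of x z] by (simp add: max_def)
  moreover have "0 < d y z + max u v" using h by (auto intro!: pos_dist_add simp: less_max_iff_disj)
  ultimately have "ln (d y z + max u v) \<le> ln (2 * max ?a ?b)" by simp
  also have "\<dots> = ln 2 + max (ln ?a) (ln ?b)" using pos by (simp add: ln_mult max_def)
  finally show ?thesis
    using h by (simp add: eq \<rho>_eq reach_def depth_def)
qed

lemma height_dist_of_\<rho>_le:
  assumes "p \<in> Y" "q \<in> Y" "\<rho> p q \<le> M"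
  shows "ln (snd q) \<le> M + ln (snd p)" "snd q \<le> exp M * snd p" "d (fst p) (fst q) \<le> exp M * snd p"
proof -
  obtain y u z v where eq: "p = (y, u)" "q = (z, v)" by (metis surj_pair)
  have h: "y \<in> Z" "z \<in> Z" "0 < u" "0 < v" using assms by (auto simp: eq mem_Y)
  let ?m = "d y z + max u v"
  have m: "2 * ln ?m - ln u - ln v \<le> M" using assms h by (simp add: eq \<rho>_eq)
  have v: "ln v \<le> ln ?m" using h by (intro ln_mono) (auto intro: add_increasing)
  then have *: "ln v \<le> M + ln u" using m by linarith
  have **: "exp M * u = exp (M + ln u)" using h by (simp add: exp_add)
  show "ln (snd q) \<le> M + ln (snd p)" using * eq by simp
  have "v = exp (ln v)" using h by simp
  also have "\<dots> \<le> exp M * u" using * unfolding ** by simp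
  finally show "snd q \<le> exp M * snd p" using eq by simp
  show "d (fst p) (fst q) \<le> exp M * snd p"
  proof (cases "d y z = 0")
    case False
    then have dp: "0 < d y z" using nonneg[of y z] by linarith
    then have "ln (d y z) \<le> ln ?m" using h by (intro ln_mono) (auto simp: le_max_iff_disj)
    then have "ln (d y z) \<le> M + ln u" using m v by linarith
    then have "exp (ln (d y z)) \<le> exp M * u" unfolding ** by simp
    then show ?thesis using dp eq by simp
  qed (use h eq in simp)
qed

text \<open>The contraction of the projection to the ray: a step of bounded length changes \<open>d x y + u\<close> by
  at most a multiple of \<open>u\<close>, and \<open>exp (- depth x p)\<close> is the quotient of \<open>u\<close> by \<open>d x y + u\<close>.\<close>

lemma reach_step:
  assumes "x \<in> Z" "p \<in> Y" "q \<in> Y" "\<rho> p q \<le> M"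
  shows "reach x q - reach x p \<le> 2 * exp M * exp (- depth x p)"
proof -
  obtain y u z v where eq: "p = (y, u)" "q = (z, v)" by (metis surj_pair)
  have h: "y \<in> Z" "z \<in> Z" "0 < u" "0 < v" using assms by (auto simp: eq mem_Y)
  let ?a = "d x y + u" and ?b = "d x z + v"
  have pos: "0 < ?a" "0 < ?b" using h by auto
  have "v \<le> exp M * u" "d y z \<le> exp M * u" using height_dist_of_\<rho>_le[OF assms(2-4)] eq by auto
  then have "?b \<le> ?a + 2 * exp M * u" using triangle[OF assms(1) h(1,2)] h by linarith
  then have "?b / ?a \<le> (?a + 2 * exp M * u) / ?a" using pos by (intro divide_right_mono) auto
  also have "\<dots> = 1 + 2 * exp M * (u / ?a)" using pos by (simp add: add_divide_distrib)
  finally have "?b / ?a \<le> 1 + 2 * exp M * (u / ?a)" .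
  moreover have "ln (?b / ?a) \<le> ?b / ?a - 1" using pos by (intro ln_le_minus_one) auto
  moreover have "ln (?b / ?a) = reach x q - reach x p" using pos by (simp add: ln_div reach_def eq)
  moreover have "u / ?a = exp (- depth x p)"
    using pos h by (simp add: depth_def reach_def eq exp_diff)
  ultimately show ?thesis by simp
qed

lemma reach_depth_steps:
  assumes "x \<in> Z" "p \<in> Y" "q \<in> Y" "\<rho> p q \<le> M"
  shows "\<bar>reach x q - reach x p\<bar> \<le> (2 * exp M + M) * max (exp (- depth x p)) (exp (- depth x q))"
    "\<bar>depth x q - depth x p\<bar> \<le> 2 * exp M + M"
proof -
  have M: "0 \<le> M" using Y.nonneg[OF assms(2,3)] assms(4) by linarith
  have qp: "\<rho> q p \<le> M" using Y.sym[OF assms(2,3)] assms(4) by simp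
  let ?m = "max (exp (- depth x p)) (exp (- depth x q))"
  have "2 * exp M * exp (- depth x p) \<le> 2 * exp M * ?m" "2 * exp M * exp (- depth x q) \<le> 2 * exp M * ?m"
    by (intro mult_left_mono; simp)+
  then have 1: "\<bar>reach x q - reach x p\<bar> \<le> 2 * exp M * ?m"
    using reach_step[OF assms] reach_step[OF assms(1,3,2) qp] by linarith
  have "0 \<le> ?m" by (simp add: max_def)
  then have "0 \<le> M * ?m" using M by simp
  then show "\<bar>reach x q - reach x p\<bar> \<le> (2 * exp M + M) * ?m" using 1 by (simp add: distrib_right)
  have "?m \<le> 1" using depth_nonneg assms by simp
  then have "2 * exp M * ?m \<le> 2 * exp M * 1" by (intro mult_left_mono) auto
  then have 2: "\<bar>reach x q - reach x p\<bar> \<le> 2 * exp M" using 1 by linarith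
  have "\<bar>ln (snd q) - ln (snd p)\<bar> \<le> M"
    using height_dist_of_\<rho>_le(1)[OF assms(2-4)] height_dist_of_\<rho>_le(1)[OF assms(3,2) qp] by linarith
  then show "\<bar>depth x q - depth x p\<bar> \<le> 2 * exp M + M" using 2 unfolding depth_def by linarith
qed

lemma gromov_sequence_vertical:
  assumes w: "w \<in> Y" and x: "x \<in> Z"
  shows "gromov_sequence Y \<rho> w (\<lambda>n. (x, D * exp (- real n)))"
proof -
  let ?p = "\<lambda>n. (x, D * exp (- real n))"
  obtain B where B: "\<And>p q. p \<in> Y \<Longrightarrow> q \<in> Y \<Longrightarrow> \<bar>gromov_product \<rho> w p q + log_size p q\<bar> \<le> B"
    using gromov_product_log_size[OF w] by blast
  have Yp: "?p n \<in> Y" for n using x D_pos by (simp add: mem_Y)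
  have size: "log_size (?p i) (?p j) = ln D - min (real i) (real j)" for i j
  proof -
    have "max (D * exp (- real i)) (D * exp (- real j)) = D * exp (- min (real i) (real j))"
      using D_pos by (auto simp: max_def min_def)
    then show ?thesis using x D_pos by (simp add: log_size_def ln_mult)
  qed
  have "filterlim (\<lambda>ij. gromov_product \<rho> w (?p (fst ij)) (?p (snd ij))) at_top (sequentially \<times>\<^sub>F sequentially)"
    unfolding filterlim_at_top
  proof
    fix c :: real
    obtain N where N: "c + B + ln D \<le> real N" using real_arch_simple by blast
    have "c \<le> gromov_product \<rho> w (?p i) (?p j)" if "N \<le> i" "N \<le> j" for i j
      using B[OF Yp[of i] Yp[of j]] N that unfolding size by (auto simp: abs_le_iff min_def split: if_splits)
    then show "\<forall>\<^sub>F ij in sequentially \<times>\<^sub>F sequentially. c \<le> gromov_product \<rho> w (?p (fst ij)) (?p (snd ij))"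
      unfolding eventually_prod_sequentially by (intro exI[of _ N]) auto
  qed
  then show ?thesis using Yp by (auto simp: gromov_sequence_def case_prod_unfold)
qed

text \<open>The images of the points of a vertical ray converge to the end of that ray. This is
  how the assumption on the boundary enters the proof of rigidity.\<close>

lemma reach_unbounded_below:
  assumes w: "w \<in> Y" and x: "x \<in> Z" and f: "\<And>p. p \<in> Y \<Longrightarrow> f p \<in> Y"
    and fid: "induces_boundary_identity Y \<rho> w f"
  shows "\<exists>n. reach x (f (x, D * exp (- real n))) < b"
proof -
  let ?p = "\<lambda>n. (x, D * exp (- real n))"
  obtain B where B: "\<And>p q. p \<in> Y \<Longrightarrow> q \<in> Y \<Longrightarrow> \<bar>gromov_product \<rho> w p q + log_size p q\<bar> \<le> B"
    using gromov_product_log_size[OF w] by blast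
  have Yp: "?p n \<in> Y" for n using x D_pos by (simp add: mem_Y)
  have "gromov_equivalent \<rho> w (f \<circ> ?p) ?p"
    using fid gromov_sequence_vertical[OF w x] unfolding induces_boundary_identity_def by blast
  then have "\<forall>\<^sub>F n in sequentially. B - b + 1 \<le> gromov_product \<rho> w (f (?p n)) (?p n)"
    unfolding gromov_equivalent_def filterlim_at_top by simp
  then obtain n where n: "B - b + 1 \<le> gromov_product \<rho> w (f (?p n)) (?p n)"
    unfolding eventually_sequentially by blast
  have "reach x (f (?p n)) \<le> log_size (f (?p n)) (?p n)"
  proof -
    have "0 < snd (f (?p n))" using f[OF Yp[of n]] by (cases "f (?p n)") (auto simp: mem_Y)
    then show ?thesis unfolding reach_def log_size_def by (intro ln_mono pos_dist_add) (auto simp: commute)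
  qed
  then show ?thesis using n B[OF f[OF Yp[of n]] Yp[of n]] by (intro exI[of _ n]) linarith
qed

text \<open>The sequence \<open>f (p x n)\<close> is the image of the vertical ray over \<open>x\<close>, and
  \<open>excursions_bounded\<close> keeps it within distance \<open>R\<close> of that ray, with the same \<open>R\<close> for all \<open>x\<close>. Two lower
  bounds for heights, one for images and one for preimages, then show that \<open>f\<close> changes
  heights by a bounded factor only.\<close>

lemma boundary_rigid_of_uniformly_perfect:
  assumes "uniformly_perfect Z d"
  shows "boundary_rigid Y \<rho>"
  unfolding boundary_rigid_def
proof (intro ballI allI impI)
  fix w f
  assume w: "w \<in> Y" and "quasi_isometry Y \<rho> Y \<rho> f \<and> induces_boundary_identity Y \<rho> w f"
  then have f: "quasi_isometry Y \<rho> Y \<rho> f" and fid: "induces_boundary_identity Y \<rho> w f" by auto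
  obtain K C where K: "K \<ge> 1" "C \<ge> 0" and fY: "\<And>p. p \<in> Y \<Longrightarrow> f p \<in> Y"
    and fl: "\<And>p q. p \<in> Y \<Longrightarrow> q \<in> Y \<Longrightarrow> \<rho> p q / K - C \<le> \<rho> (f p) (f q)"
    and fu: "\<And>p q. p \<in> Y \<Longrightarrow> q \<in> Y \<Longrightarrow> \<rho> (f p) (f q) \<le> K * \<rho> p q + C"
    using f unfolding quasi_isometry_def by blast
  obtain S where S: "1 \<le> S" and up: "\<And>x s. x \<in> Z \<Longrightarrow> 0 < s \<Longrightarrow> s \<le> D \<Longrightarrow> \<exists>y\<in>Z. s / S < d x y \<and> d x y \<le> s"
    using uniformly_perfect_up_to[OF assms D_pos] by blast
  define A where "A = 2 * exp (K + C) + (K + C)"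
  have A: "0 \<le> A" using K by (simp add: A_def)
  define p :: "'a \<Rightarrow> nat \<Rightarrow> 'a \<times> real" where "p = (\<lambda>x n. (x, D * exp (- real n)))"
  have pY: "x \<in> Z \<Longrightarrow> p x n \<in> Y" for x n using D_pos by (simp add: p_def mem_Y)
  have pp: "x \<in> Z \<Longrightarrow> \<rho> (p x n) (p x m) = \<bar>real n - real m\<bar>" for x n m
    using D_pos by (simp add: p_def \<rho>_vertical ln_mult)
  obtain z0 where z0: "z0 \<in> Z" using nonempty by blast
  have close: "\<rho> (x, s) (y, s) \<le> 2 * ln 2" if "x \<in> Z" "y \<in> Z" "0 < s" "d x y \<le> s" for x y s
  proof -
    have "ln (d x y + s) \<le> ln (2 * s)" using that by (intro ln_mono) auto
    also have "\<dots> = ln 2 + ln s" using that by (simp add: ln_mult)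
    finally show ?thesis using that by (simp add: \<rho>_eq)
  qed
  \<comment> \<open>The tops of all rays are close to each other, so their images start at heights bounded below by \<open>exp b\<close>.\<close>
  define b where "b = ln (snd (f (p z0 0))) - (K * (2 * ln 2) + C)"
  have b: "b \<le> ln (snd (f (p x 0)))" if x: "x \<in> Z" for x
  proof -
    have "\<rho> (p x 0) (p z0 0) \<le> 2 * ln 2" unfolding p_def using close[OF x z0] dist_le[OF x z0] D_pos by simp
    then have "K * \<rho> (p x 0) (p z0 0) \<le> K * (2 * ln 2)" using K by (intro mult_left_mono) auto
    then have "\<rho> (f (p x 0)) (f (p z0 0)) \<le> K * (2 * ln 2) + C" using fu[OF pY[OF x, of 0] pY[OF z0, of 0]] by linarith
    from height_dist_of_\<rho>_le(1)[OF fY[OF pY[OF x]] fY[OF pY[OF z0]] this] show ?thesis unfolding b_def by linarith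
  qed
  have C2: "0 \<le> C + 2 * ln 2" using K by simp
  from excursions_bounded[OF K(1) C2 A, of "ln (2 * D) - b"]
  obtain R where R: "\<forall>\<alpha> \<delta> :: nat \<Rightarrow> real.
    (\<forall>n m. \<bar>real n - real m\<bar> / K - (C + 2 * ln 2) \<le> \<bar>\<alpha> n - \<alpha> m\<bar> + \<delta> n + \<delta> m) \<longrightarrow>
    (\<forall>n. \<bar>\<alpha> (Suc n) - \<alpha> n\<bar> \<le> A * max (exp (- \<delta> n)) (exp (- \<delta> (Suc n)))) \<longrightarrow>
    (\<forall>n. \<bar>\<delta> (Suc n) - \<delta> n\<bar> \<le> A) \<longrightarrow>
    \<delta> 0 \<le> ln (2 * D) - b \<longrightarrow> (\<forall>B. \<exists>n. \<alpha> n < B) \<longrightarrow> (\<forall>n. \<delta> n \<le> R)" ..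
  have step: "\<rho> (f (p x n)) (f (p x (Suc n))) \<le> K + C" if "x \<in> Z" for x n
    using fu[OF pY[OF that, of n] pY[OF that, of "Suc n"]] pp[OF that, of n "Suc n"] by simp
  have depth: "depth x (f (p x n)) \<le> R" if x: "x \<in> Z" for x n
  proof (rule R[rule_format, where \<alpha> = "\<lambda>n. reach x (f (p x n))" and \<delta> = "\<lambda>n. depth x (f (p x n))"])
    fix n m
    show "\<bar>real n - real m\<bar> / K - (C + 2 * ln 2)
       \<le> \<bar>reach x (f (p x n)) - reach x (f (p x m))\<bar> + depth x (f (p x n)) + depth x (f (p x m))"
      using fl[OF pY[OF x, of n] pY[OF x, of m], unfolded pp[OF x]] \<rho>_le_reach_depth[OF x fY[OF pY[OF x, of n]] fY[OF pY[OF x, of m]]]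
      by linarith
    show "\<bar>reach x (f (p x (Suc n))) - reach x (f (p x n))\<bar> \<le> A * max (exp (- depth x (f (p x n)))) (exp (- depth x (f (p x (Suc n)))))"
      "\<bar>depth x (f (p x (Suc n))) - depth x (f (p x n))\<bar> \<le> A"
      unfolding A_def by (rule reach_depth_steps[OF x fY[OF pY[OF x]] fY[OF pY[OF x]] step[OF x]])+
    show "depth x (f (p x 0)) \<le> ln (2 * D) - b"
      using b[OF x] reach_le[OF x fY[OF pY[OF x, of 0]]] unfolding depth_def by linarith
    show "\<exists>n. reach x (f (p x n)) < B" for B
      unfolding p_def by (rule reach_unbounded_below[OF w x fY fid])
  qed
  define M where "M = 2 * ln 2 + (A + (ln D - b)) + R"
  \<comment> \<open>The projections of the images descend in bounded steps, so no point of the ray is missed by much.\<close>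
  have near: "\<exists>n. \<rho> (f (p x n)) (x, s) \<le> M" if x: "x \<in> Z" and s: "0 < s" "s \<le> D" for x s
  proof -
    have xs: "(x, s) \<in> Y" using x s by (simp add: mem_Y)
    have db: "0 \<le> ln D - b"
      using b[OF x] fY[OF pY[OF x, of 0]] by (cases "f (p x 0)") (auto simp: mem_Y intro: order_trans)
    have "\<exists>n. \<bar>reach x (f (p x n)) - ln s\<bar> \<le> A + (ln D - b)"
    proof (cases "reach x (f (p x 0)) \<le> ln s")
      case True
      have "b \<le> reach x (f (p x 0))" using b[OF x] reach_ge[OF x fY[OF pY[OF x, of 0]]] by linarith
      moreover have "ln s \<le> ln D" using s by simp
      ultimately show ?thesis using True A by (intro exI[of _ 0]) linarith
    next
      case False
      define n where "n = (LEAST n. reach x (f (p x n)) \<le> ln s)"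
      obtain k where "reach x (f (p x k)) < ln s"
        using reach_unbounded_below[OF w x fY fid] unfolding p_def by blast
      then have n: "reach x (f (p x n)) \<le> ln s"
        unfolding n_def by (intro LeastI[of "\<lambda>n. reach x (f (p x n)) \<le> ln s" k]) simp
      then obtain m where m: "n = Suc m" using False by (cases n) auto
      have "\<not> reach x (f (p x m)) \<le> ln s" using not_less_Least[of m "\<lambda>n. reach x (f (p x n)) \<le> ln s"] m n_def by simp
      moreover have "\<bar>reach x (f (p x n)) - reach x (f (p x m))\<bar> \<le> A"
      proof -
        have "max (exp (- depth x (f (p x m)))) (exp (- depth x (f (p x n)))) \<le> 1"
          using depth_nonneg[OF x fY[OF pY[OF x]]] by simp
        from mult_left_mono[OF this A] show ?thesis
          using reach_depth_steps(1)[OF x fY[OF pY[OF x, of m]] fY[OF pY[OF x, of "Suc m"]] step[OF x]]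
          unfolding m A_def by simp
      qed
      ultimately show ?thesis using n db by (intro exI[of _ n]) linarith
    qed
    then obtain n where n: "\<bar>reach x (f (p x n)) - ln s\<bar> \<le> A + (ln D - b)" by blast
    have r: "reach x (x, s) = ln s" using x by (simp add: reach_def)
    have "\<rho> (f (p x n)) (x, s) \<le> M"
      using \<rho>_le_reach_depth[OF x fY[OF pY[OF x, of n]] xs] depth[OF x, of n] n
      unfolding M_def r depth_def[of x "(x, s)"] snd_conv by linarith
    then show ?thesis ..
  qed
  have shadow: "d x (fst (f (p x n))) \<le> exp R * snd (f (p x n))" if x: "x \<in> Z" for x n
  proof -
    have h: "0 < snd (f (p x n))" using fY[OF pY[OF x, of n]] by (cases "f (p x n)") (auto simp: mem_Y)
    have "ln (d x (fst (f (p x n))) + snd (f (p x n))) \<le> R + ln (snd (f (p x n)))"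
      using depth[OF x, of n] unfolding depth_def reach_def by linarith
    then have "exp (ln (d x (fst (f (p x n))) + snd (f (p x n)))) \<le> exp (R + ln (snd (f (p x n))))"
      by (simp only: exp_le_cancel_iff)
    then have "d x (fst (f (p x n))) + snd (f (p x n)) \<le> exp (R + ln (snd (f (p x n))))"
      using h by (simp only: exp_ln pos_dist_add)
    then show ?thesis using h by (simp add: exp_add)
  qed
  \<comment> \<open>Lower bound for the heights of images: compare \<open>f (p x n)\<close> and \<open>f (p y n)\<close>, where \<open>d x y\<close> is about the height of \<open>p x n\<close>.\<close>
  define Q where "Q = exp R + exp (K * (2 * ln 2) + C) + exp R * exp (K * (2 * ln 2) + C)"
  have Q: "0 < Q" by (simp add: Q_def add_pos_pos)
  have lower: "D * exp (- real n) / S \<le> Q * snd (f (p x n))" if x: "x \<in> Z" for x n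
  proof -
    let ?s = "D * exp (- real n)" and ?M = "K * (2 * ln 2) + C"
    obtain y where y: "y \<in> Z" "?s / S < d x y" "d x y \<le> ?s"
      using up[OF x, of ?s] D_pos by auto
    let ?u = "snd (f (p x n))" and ?v = "snd (f (p y n))"
    have "\<rho> (p x n) (p y n) \<le> 2 * ln 2" unfolding p_def using close x y D_pos by simp
    then have "K * \<rho> (p x n) (p y n) \<le> K * (2 * ln 2)" using K by (intro mult_left_mono) auto
    then have "\<rho> (f (p x n)) (f (p y n)) \<le> ?M" using fu[OF pY[OF x, of n] pY[OF y(1), of n]] by linarith
    note hd = height_dist_of_\<rho>_le(2,3)[OF fY[OF pY[OF x]] fY[OF pY[OF y(1)]] this]
    have F: "fst (f (p x n)) \<in> Z" "fst (f (p y n)) \<in> Z"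
      using fY[OF pY[OF x, of n]] fY[OF pY[OF y(1), of n]] by (cases "f (p x n)"; cases "f (p y n)"; simp add: mem_Y)+
    have "d x y \<le> d x (fst (f (p x n))) + d (fst (f (p x n))) (fst (f (p y n))) + d y (fst (f (p y n)))"
      using triangle[OF x F(1) y(1)] triangle[OF F(1) F(2) y(1)] commute[of y "fst (f (p y n))"] by linarith
    also have "\<dots> \<le> exp R * ?u + exp ?M * ?u + exp R * ?v"
      using shadow[OF x] shadow[OF y(1)] hd by (intro add_mono) auto
    also have "\<dots> \<le> exp R * ?u + exp ?M * ?u + exp R * (exp ?M * ?u)"
      using hd by (intro add_mono mult_left_mono) auto
    also have "\<dots> = Q * ?u" by (simp add: Q_def algebra_simps)
    finally show ?thesis using y by linarith
  qed
  \<comment> \<open>Lower bound for the heights of preimages: compare points mapped close to \<open>(x, s)\<close> and to \<open>(y, s)\<close>, where \<open>d x y\<close> is about \<open>s\<close>.\<close>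
  define M' where "M' = K * (2 * M + 2 * ln 2 + C)"
  have upper: "s / S \<le> exp M' * (D * exp (- real n))"
    if x: "x \<in> Z" and s: "0 < s" "s \<le> D" and n: "\<rho> (f (p x n)) (x, s) \<le> M" for x s n
  proof -
    obtain y where y: "y \<in> Z" "s / S < d x y" "d x y \<le> s" using up[OF x s] by blast
    obtain m where m: "\<rho> (f (p y m)) (y, s) \<le> M" using near[OF y(1) s] by blast
    have xs: "(x, s) \<in> Y" "(y, s) \<in> Y" using x y s by (auto simp: mem_Y)
    have "\<rho> (f (p x n)) (f (p y m)) \<le> 2 * M + 2 * ln 2"
      using Y.tri[OF fY[OF pY[OF x, of n]] xs(1) fY[OF pY[OF y(1), of m]]] Y.tri[OF xs fY[OF pY[OF y(1), of m]]]
        close[OF x y(1) s(1) y(3)] n m Y.sym[OF xs(2) fY[OF pY[OF y(1), of m]]] by linarith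
    then have "\<rho> (p x n) (p y m) / K \<le> 2 * M + 2 * ln 2 + C" using fl[OF pY[OF x, of n] pY[OF y(1), of m]] by linarith
    then have "\<rho> (p x n) (p y m) \<le> M'" using K by (simp add: M'_def field_simps)
    from height_dist_of_\<rho>_le(3)[OF pY[OF x] pY[OF y(1)] this] show ?thesis using y(2) by (simp add: p_def)
  qed
  define L where "L = \<bar>M' + ln S\<bar> + \<bar>ln S + ln Q + M\<bar>"
  have "\<rho> xs (f xs) \<le> M + (K * L + C)" if xs: "xs \<in> Y" for xs
  proof -
    obtain x s where eq: "xs = (x, s)" by fastforce
    have x: "x \<in> Z" and s: "0 < s" "s \<le> D" using xs by (auto simp: eq mem_Y)
    obtain n where n: "\<rho> (f (p x n)) xs \<le> M" using near[OF x s] eq by blast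
    let ?t = "D * exp (- real n)"
    have "s / S \<le> exp M' * ?t" using upper[OF x s] n eq by simp
    then have "s \<le> S * exp M' * ?t" using S by (simp add: field_simps)
    then have "ln s \<le> ln (S * exp M' * ?t)" using s by (intro ln_mono) auto
    then have 1: "ln s \<le> ln S + M' + ln ?t" using S D_pos by (simp add: ln_mult)
    have h: "0 < snd (f (p x n))" using fY[OF pY[OF x, of n]] by (cases "f (p x n)") (auto simp: mem_Y)
    have "?t \<le> S * Q * snd (f (p x n))" using lower[OF x, of n] S by (simp add: field_simps)
    then have "ln ?t \<le> ln (S * Q * snd (f (p x n)))" using D_pos by (intro ln_mono) auto
    also have "\<dots> = ln S + ln Q + ln (snd (f (p x n)))" using S Q h by (simp add: ln_mult)
    also have "ln (snd (f (p x n))) \<le> M + ln s"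
      using height_dist_of_\<rho>_le(1)[OF xs fY[OF pY[OF x]]] n Y.sym[OF xs fY[OF pY[OF x, of n]]] by (simp add: eq)
    finally have 2: "ln ?t \<le> ln S + ln Q + M + ln s" by simp
    have "\<rho> (p x n) xs \<le> L"
      using 1 2 x s D_pos unfolding eq p_def L_def by (subst \<rho>_vertical) auto
    then have "K * \<rho> (p x n) xs \<le> K * L" using K by (intro mult_left_mono) auto
    then have "\<rho> (f (p x n)) (f xs) \<le> K * L + C" using fu[OF pY[OF x, of n] xs] by linarith
    then show ?thesis
      using n Y.tri[OF xs fY[OF pY[OF x, of n]] fY[OF xs]] Y.sym[OF xs fY[OF pY[OF x, of n]]] by linarith
  qed
  then show "bdd_above ((\<lambda>xs. \<rho> xs (f xs)) ` Y)" by (rule bdd_aboveI2)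
qed

end


section \<open>Gaps in the distances give shifts of the cone\<close>

context hyperbolic_cone
begin

text \<open>The logarithmic heights that are pinned down at \<open>x\<close>: those at which the ray over \<open>x\<close> meets
  the ray over another point, and the top of the cone.\<close>

definition scales :: "'a \<Rightarrow> real set" where
  "scales x = insert (ln D) ((\<lambda>y. ln (d x y)) ` (Z - {x}))"

text \<open>Half of the distance to the pinned heights: the factor \<open>1 / 2\<close> makes
  \<open>raise x\<close> below bilipschitz with constants \<open>1 / 2\<close> and \<open>3 / 2\<close>, and keeps it below \<open>ln D\<close>.\<close>

definition lift :: "'a \<Rightarrow> real \<Rightarrow> real" where
  "lift x \<tau> = infdist \<tau> (scales x) / 2"

definition raise :: "'a \<Rightarrow> real \<Rightarrow> real" where
  "raise x \<tau> = \<tau> + lift x \<tau>"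

definition shift :: "'a \<times> real \<Rightarrow> 'a \<times> real" where
  "shift p = (fst p, exp (raise (fst p) (ln (snd p))))"

lemma lift_nonneg: "0 \<le> lift x \<tau>"
  by (simp add: lift_def infdist_nonneg)

lemma lift_le: "e \<in> scales x \<Longrightarrow> lift x \<tau> \<le> \<bar>\<tau> - e\<bar> / 2"
  using infdist_le[of e "scales x" \<tau>] by (simp add: lift_def dist_real_def)

lemma lift_Lipschitz: "\<bar>lift x \<sigma> - lift x \<tau>\<bar> \<le> \<bar>\<sigma> - \<tau>\<bar> / 2"
proof -
  have "\<bar>lift x \<sigma> - lift x \<tau>\<bar> = \<bar>infdist \<sigma> (scales x) - infdist \<tau> (scales x)\<bar> / 2"
    unfolding lift_def diff_divide_distrib[symmetric] by simp
  then show ?thesis using infdist_triangle_abs[of \<sigma> "scales x" \<tau>] by (simp add: dist_real_def)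
qed

lemma raise_bilipschitz:
  assumes "\<sigma> \<le> \<tau>"
  shows "(\<tau> - \<sigma>) / 2 \<le> raise x \<tau> - raise x \<sigma>" "raise x \<tau> - raise x \<sigma> \<le> 3 / 2 * (\<tau> - \<sigma>)"
proof -
  have *: "\<bar>lift x \<sigma> - lift x \<tau>\<bar> \<le> (\<tau> - \<sigma>) / 2" using lift_Lipschitz[of x \<sigma> \<tau>] assms by simp
  then have "lift x \<sigma> - lift x \<tau> \<le> (\<tau> - \<sigma>) / 2" "lift x \<tau> - lift x \<sigma> \<le> (\<tau> - \<sigma>) / 2"
    using abs_le_D1[OF *] abs_le_D2[OF *] by (simp_all only: minus_diff_eq)
  then show "(\<tau> - \<sigma>) / 2 \<le> raise x \<tau> - raise x \<sigma>" "raise x \<tau> - raise x \<sigma> \<le> 3 / 2 * (\<tau> - \<sigma>)"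
    unfolding raise_def by (simp_all add: field_simps)
qed

lemma raise_mono: "\<sigma> \<le> \<tau> \<Longrightarrow> raise x \<sigma> \<le> raise x \<tau>"
  using raise_bilipschitz(1)[of \<sigma> \<tau> x] by (simp add: field_simps)

lemma raise_le:
  assumes "\<tau> \<le> ln D" shows "raise x \<tau> \<le> (\<tau> + ln D) / 2"
  using lift_le[of "ln D" x \<tau>] assms by (simp add: scales_def raise_def field_simps)

text \<open>Where the rays over \<open>x\<close> and \<open>y\<close> are close, the two lifts agree up to a constant. A distance
  \<open>d x z\<close> is comparable with \<open>d y z\<close> if \<open>z\<close> is farther away from \<open>x\<close> than \<open>2 * d x y\<close>; otherwise
  \<open>d y x\<close> lies between \<open>d x z / 2\<close> and \<open>exp \<tau>\<close>, so that its logarithm is as near to \<open>\<tau>\<close> as that of \<open>d x z\<close>, up to \<open>ln 2\<close>.\<close>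

lemma lift_compare:
  assumes x: "x \<in> Z" and y: "y \<in> Z" and le: "d x y \<le> exp \<tau>"
  shows "lift y \<tau> \<le> lift x \<tau> + ln 2 / 2"
proof (cases "x = y")
  case True
  then show ?thesis by simp
next
  case False
  have "infdist \<tau> (scales y) - ln 2 \<le> (INF e\<in>scales x. dist \<tau> e)"
  proof (rule cINF_greatest)
    show "scales x \<noteq> {}" by (simp add: scales_def)
    fix e assume "e \<in> scales x"
    then consider "e = ln D" | z where "z \<in> Z" "z \<noteq> x" "e = ln (d x z)" by (auto simp: scales_def)
    then have "\<exists>e'\<in>scales y. dist \<tau> e' \<le> dist \<tau> e + ln 2"
    proof cases
      case 1
      then show ?thesis by (intro bexI[of _ "ln D"]) (auto simp: scales_def)
    next
      case z: 2
      have pos: "0 < d x z" "0 < d x y" using x y z False by (simp_all add: mdist_pos_less)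
      show ?thesis
      proof (cases "d x y < d x z / 2")
        case True
        have "y \<noteq> z" using True pos by auto
        then have e': "ln (d y z) \<in> scales y" using z by (auto simp: scales_def)
        have "d x z / 2 \<le> d y z" "d y z \<le> 2 * d x z"
          using triangle[OF x y z(1)] triangle[OF y x z(1)] commute[of x y] True pos by linarith+
        then have "ln (d x z / 2) \<le> ln (d y z)" "ln (d y z) \<le> ln (2 * d x z)" using pos by (intro ln_mono; simp)+
        then have "\<bar>ln (d y z) - ln (d x z)\<bar> \<le> ln 2" using pos by (simp add: ln_div ln_mult abs_le_iff)
        then show ?thesis using e' unfolding z(3) by (intro bexI[OF _ e']) (auto simp: dist_real_def abs_le_iff)
      next
        case far: False
        have e': "ln (d y x) \<in> scales y" using x False by (auto simp: scales_def)
        have "ln (d x y) \<le> ln (exp \<tau>)" using le pos by (intro ln_mono) auto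
        moreover have "ln (d x z / 2) \<le> ln (d x y)" using far pos by (intro ln_mono) auto
        ultimately have "dist \<tau> (ln (d y x)) \<le> dist \<tau> e + ln 2"
          using pos unfolding z(3) commute[of y x] dist_real_def by (simp add: ln_div)
        then show ?thesis using e' by blast
      qed
    qed
    then obtain e' where "e' \<in> scales y" "dist \<tau> e' \<le> dist \<tau> e + ln 2" by blast
    then show "infdist \<tau> (scales y) - ln 2 \<le> dist \<tau> e" using infdist_le[of e' "scales y" \<tau>] by linarith
  qed
  also have "\<dots> = infdist \<tau> (scales x)" by (simp add: infdist_def scales_def)
  finally show ?thesis by (simp add: lift_def field_simps)
qed

lemma log_size_ge:
  assumes "p \<in> Y" "q \<in> Y"
  shows "ln (snd p) \<le> log_size p q" "ln (snd q) \<le> log_size p q"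
    "fst p \<noteq> fst q \<Longrightarrow> ln (d (fst p) (fst q)) \<le> log_size p q"
    "d (fst p) (fst q) \<le> exp (log_size p q)"
proof -
  have h: "fst p \<in> Z" "fst q \<in> Z" "0 < snd p" "0 < snd q" using assms by (cases p; cases q; simp add: mem_Y)+
  have pos: "0 < d (fst p) (fst q) + max (snd p) (snd q)" using h by (auto intro!: pos_dist_add simp: less_max_iff_disj)
  show "ln (snd p) \<le> log_size p q" "ln (snd q) \<le> log_size p q"
    unfolding log_size_def using h by (auto intro!: ln_mono add_increasing)
  show "ln (d (fst p) (fst q)) \<le> log_size p q" if "fst p \<noteq> fst q"
    unfolding log_size_def using h that by (auto intro!: ln_mono simp: mdist_pos_less le_max_iff_disj)
  have "exp (log_size p q) = d (fst p) (fst q) + max (snd p) (snd q)"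
    unfolding log_size_def using pos by (rule exp_ln)
  then show "d (fst p) (fst q) \<le> exp (log_size p q)" using h by (simp add: le_max_iff_disj)
qed

lemma log_size_sym: "log_size p q = log_size q p"
  by (simp add: log_size_def commute max.commute)

lemma shift_Y:
  assumes "p \<in> Y" shows "shift p \<in> Y"
proof -
  obtain x s where p: "p = (x, s)" by fastforce
  have h: "x \<in> Z" "0 < s" "s \<le> D" using assms by (auto simp: p mem_Y)
  have l: "ln s \<le> ln D" using h by simp
  then have "raise x (ln s) \<le> ln D" using raise_le[OF l, of x] l by (simp add: field_simps)
  then have "exp (raise x (ln s)) \<le> exp (ln D)" by (simp only: exp_le_cancel_iff)
  then show ?thesis using h D_pos by (simp add: p shift_def mem_Y)
qed

text \<open>The shift moves the meeting height of two rays as if it were a point of one of them: if the meeting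
  height is about \<open>d x y\<close>, it is a scale of \<open>x\<close> and both sides stay put; if it is about the height of one
  of the points, that point carries it along.\<close>

lemma log_size_shift:
  assumes p: "p \<in> Y" and q: "q \<in> Y"
  shows "\<bar>log_size (shift p) (shift q) - raise (fst p) (log_size p q)\<bar> \<le> 2 * ln 2"
proof -
  obtain x s y t where eq: "p = (x, s)" "q = (y, t)" by (metis surj_pair)
  have h: "x \<in> Z" "y \<in> Z" "0 < s" "0 < t" using p q by (auto simp: eq mem_Y)
  define \<mu> where "\<mu> = log_size p q"
  define \<mu>' where "\<mu>' = log_size (shift p) (shift q)"
  have pos: "0 < d x y + max s t" using h by (auto intro!: pos_dist_add simp: less_max_iff_disj)
  have exp\<mu>: "exp \<mu> = d x y + max s t" unfolding \<mu>_def log_size_def eq using pos by simp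
  have \<mu>: "ln s \<le> \<mu>" "ln t \<le> \<mu>" "d x y \<le> exp \<mu>" using log_size_ge[OF p q] by (simp_all add: eq \<mu>_def)
  have \<mu>'1: "raise x (ln s) \<le> \<mu>'" "raise y (ln t) \<le> \<mu>'"
    using log_size_ge(1,2)[OF shift_Y[OF p] shift_Y[OF q]] by (simp_all add: \<mu>'_def eq shift_def)
  have \<mu>'2: "ln (d x y) \<le> \<mu>'" if "x \<noteq> y"
    using log_size_ge(3)[OF shift_Y[OF p] shift_Y[OF q]] that by (simp add: \<mu>'_def eq shift_def)
  have xy: "raise y \<mu> \<le> raise x \<mu> + ln 2 / 2" and yx: "raise x \<mu> \<le> raise y \<mu> + ln 2 / 2"
    using lift_compare[OF h(1,2) \<mu>(3)] lift_compare[OF h(2,1), of \<mu>] \<mu>(3)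
    by (simp_all add: raise_def commute)
  let ?g = "exp (raise x \<mu>)"
  have "exp (raise x (ln s)) \<le> ?g" using raise_mono[OF \<mu>(1)] by simp
  moreover have "exp (raise y (ln t)) \<le> exp (ln 2 + raise x \<mu>)"
  proof -
    have "0 \<le> ln (2::real)" by simp
    then have "raise y (ln t) \<le> ln 2 + raise x \<mu>" using raise_mono[OF \<mu>(2), of y] xy by linarith
    then show ?thesis by simp
  qed
  moreover have "d x y \<le> ?g"
    using \<mu>(3) lift_nonneg[of x \<mu>] by (rule_tac order_trans[OF \<mu>(3)]) (simp add: raise_def)
  moreover have "0 \<le> ?g" by simp
  moreover have "exp (ln 2 + raise x \<mu>) = 2 * ?g" by (simp add: exp_add)
  moreover have "e + max a b \<le> 4 * g" if "a \<le> g" "b \<le> 2 * g" "e \<le> g" "0 \<le> g" for a b e g :: real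
    using that by (simp add: max_def)
  ultimately have "d x y + max (exp (raise x (ln s))) (exp (raise y (ln t))) \<le> 4 * ?g"
    by metis
  then have "ln (d x y + max (exp (raise x (ln s))) (exp (raise y (ln t)))) \<le> ln (4 * ?g)"
    by (intro ln_mono) (auto intro!: pos_dist_add simp: less_max_iff_disj)
  also have "ln (4 * ?g) = ln (2 ^ 2) + raise x \<mu>" by (simp add: ln_mult)
  also have "ln (2 ^ 2 :: real) = 2 * ln 2" by (subst ln_realpow) auto
  finally have upper: "\<mu>' \<le> raise x \<mu> + 2 * ln 2" by (simp add: \<mu>'_def log_size_def eq shift_def)
  have l2: "0 \<le> ln (2::real)" by simp
  consider "max s t < d x y" | "exp \<mu> \<le> 2 * s" | "exp \<mu> \<le> 2 * t"
    using exp\<mu> by (cases "max s t < d x y"; cases "s \<le> t") (simp_all add: max_def)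
  then have lower: "raise x \<mu> \<le> \<mu>' + 2 * ln 2"
  proof cases
    case 1
    then have dp: "0 < d x y" using h(3) by linarith
    then have ne: "x \<noteq> y" using h by auto
    have "exp \<mu> \<le> 2 * d x y" using 1 exp\<mu> by linarith
    then have "ln (exp \<mu>) \<le> ln (2 * d x y)" using dp by (intro ln_mono) auto
    also have "\<dots> = ln 2 + ln (d x y)" using dp by (simp add: ln_mult)
    finally have 2: "\<mu> \<le> ln 2 + ln (d x y)" by simp
    have "ln (d x y) \<le> \<mu>" using log_size_ge(3)[OF p q] ne by (simp add: eq \<mu>_def)
    moreover have "ln (d x y) \<in> scales x" using h ne by (auto simp: scales_def)
    ultimately have "lift x \<mu> \<le> ln 2 / 2" using lift_le[of "ln (d x y)" x \<mu>] 2 by (simp add: field_simps)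
    then show ?thesis using 2 \<mu>'2[OF ne] l2 unfolding raise_def by linarith
  next
    case 2
    have "ln (exp \<mu>) \<le> ln (2 * s)" using 2 by (intro ln_mono) auto
    then have "\<mu> \<le> ln 2 + ln s" using h by (simp add: ln_mult)
    then have "3 / 2 * (\<mu> - ln s) \<le> 3 / 2 * ln 2" by simp
    then show ?thesis using raise_bilipschitz(2)[OF \<mu>(1), of x] \<mu>'1(1) l2 by linarith
  next
    case 3
    have "ln (exp \<mu>) \<le> ln (2 * t)" using 3 by (intro ln_mono) auto
    then have "\<mu> \<le> ln 2 + ln t" using h by (simp add: ln_mult)
    then have "3 / 2 * (\<mu> - ln t) \<le> 3 / 2 * ln 2" by simp
    then show ?thesis using raise_bilipschitz(2)[OF \<mu>(2), of y] \<mu>'1(2) yx l2 by linarith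
  qed
  show ?thesis using upper lower unfolding \<mu>_def \<mu>'_def eq by (simp add: abs_le_iff)
qed

lemma \<rho>_log_size: "p \<in> Y \<Longrightarrow> q \<in> Y \<Longrightarrow> \<rho> p q = 2 * log_size p q - ln (snd p) - ln (snd q)"
  by (cases p; cases q) (simp add: \<rho>_eq mem_Y log_size_def)

text \<open>Write a distance as the sum of the two vertical distances to the meeting height. The shift maps
  each of them by a bilipschitz function, up to a bounded error. It is onto since \<open>raise x\<close> is continuous.\<close>

lemma quasi_isometry_shift: "quasi_isometry Y \<rho> Y \<rho> shift"
proof (rule quasi_isometryI[of _ _ _ 2 "4 * ln 2"])
  fix p q assume p: "p \<in> Y" and q: "q \<in> Y"
  let ?\<mu> = "log_size p q" and ?\<mu>' = "log_size (shift p) (shift q)"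
  have 1: "\<bar>?\<mu>' - raise (fst p) ?\<mu>\<bar> \<le> 2 * ln 2" by (rule log_size_shift[OF p q])
  have 2: "\<bar>?\<mu>' - raise (fst q) ?\<mu>\<bar> \<le> 2 * ln 2"
    using log_size_shift[OF q p] by (simp add: log_size_sym)
  have 3: "\<rho> (shift p) (shift q) = 2 * ?\<mu>' - raise (fst p) (ln (snd p)) - raise (fst q) (ln (snd q))"
    using \<rho>_log_size[OF shift_Y[OF p] shift_Y[OF q]] by (simp add: shift_def)
  note 4 = raise_bilipschitz[OF log_size_ge(1)[OF p q], of "fst p"]
  note 5 = raise_bilipschitz[OF log_size_ge(2)[OF p q], of "fst q"]
  note 6 = \<rho>_log_size[OF p q]
  show "\<rho> p q / 2 - 4 * ln 2 \<le> \<rho> (shift p) (shift q)"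
    using abs_le_D2[OF 1] abs_le_D2[OF 2] 4(1) 5(1) unfolding 3 6 by (simp add: field_simps)
  have "0 \<le> \<rho> p q" using p q by (rule Y.nonneg)
  then show "\<rho> (shift p) (shift q) \<le> 2 * \<rho> p q + 4 * ln 2"
    using abs_le_D1[OF 1] abs_le_D1[OF 2] 4(2) 5(2) unfolding 3 6 by (simp add: field_simps)
next
  fix p assume p: "p \<in> Y"
  obtain x s where eq: "p = (x, s)" by fastforce
  have h: "x \<in> Z" "0 < s" "s \<le> D" using p by (auto simp: eq mem_Y)
  let ?a = "2 * ln s - ln D"
  have l: "ln s \<le> ln D" using h by simp
  have "raise x ?a \<le> ln s" using raise_le[of ?a x] l by simp
  moreover have "ln s \<le> raise x (ln s)" using lift_nonneg[of x "ln s"] by (simp add: raise_def)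
  moreover have "continuous_on {?a..ln s} (raise x)"
    unfolding raise_def[abs_def] lift_def by (auto intro!: continuous_intros)
  ultimately obtain \<tau> where \<tau>: "?a \<le> \<tau>" "\<tau> \<le> ln s" "raise x \<tau> = ln s"
    using IVT'[of "raise x" ?a "ln s" "ln s"] l by auto
  have "exp \<tau> \<le> exp (ln s)" using \<tau> by (simp only: exp_le_cancel_iff)
  then have "(x, exp \<tau>) \<in> Y" using h by (simp add: mem_Y)
  moreover have "shift (x, exp \<tau>) = p" using \<tau> h by (simp add: shift_def eq)
  ultimately show "\<exists>q\<in>Y. \<rho> p (shift q) \<le> 4 * ln 2" using Y.refl[OF p] by (intro bexI[of _ "(x, exp \<tau>)"]) auto
qed (auto intro: shift_Y)

text \<open>As the top of the cone is a scale, raising at most halves the logarithmic distance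
  from the top. So points tending to the boundary still do so after the shift.\<close>

lemma log_size_shift_le:
  assumes p: "p \<in> Y" and q: "q \<in> Y"
  shows "log_size (shift p) (shift q) \<le> (log_size p q + ln D) / 2 + 3 * ln 2"
proof -
  let ?\<mu> = "log_size p q"
  have h: "fst p \<in> Z" "fst q \<in> Z" "0 < snd p" "snd p \<le> D" "snd q \<le> D" using p q by (cases p; cases q; simp add: mem_Y)+
  have "?\<mu> \<le> ln (2 * D)"
    unfolding log_size_def using h dist_le[OF h(1,2)]
    by (intro ln_mono) (auto intro!: pos_dist_add simp: less_max_iff_disj)
  then have "?\<mu> \<le> ln 2 + ln D" using D_pos by (simp add: ln_mult)
  moreover have "lift (fst p) ?\<mu> \<le> \<bar>?\<mu> - ln D\<bar> / 2" by (rule lift_le) (simp add: scales_def)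
  moreover have "0 \<le> ln (2::real)" by simp
  moreover have "b + l \<le> (b + e) / 2 + c" if "b \<le> c + e" "l \<le> \<bar>b - e\<bar> / 2" "0 \<le> c" for b c e l :: real
    using that by (cases "b \<le> e") (simp_all add: field_simps)
  ultimately have "raise (fst p) ?\<mu> \<le> (?\<mu> + ln D) / 2 + ln 2" unfolding raise_def by blast
  then show ?thesis using abs_le_D1[OF log_size_shift[OF p q]] by linarith
qed

lemma induces_boundary_identity_shift:
  assumes w: "w \<in> Y"
  shows "induces_boundary_identity Y \<rho> w shift"
  unfolding induces_boundary_identity_def
proof (intro allI impI)
  fix q assume "gromov_sequence Y \<rho> w q"
  then have qY: "\<And>i. q i \<in> Y"
    and lim: "filterlim (\<lambda>(i, j). gromov_product \<rho> w (q i) (q j)) at_top (sequentially \<times>\<^sub>F sequentially)"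
    by (auto simp: gromov_sequence_def)
  obtain B where B: "\<And>p q. p \<in> Y \<Longrightarrow> q \<in> Y \<Longrightarrow> \<bar>gromov_product \<rho> w p q + log_size p q\<bar> \<le> B"
    using gromov_product_log_size[OF w] by blast
  define c where "c = 3 / 2 * B + ln D / 2 + 3 * ln 2"
  have "filterlim (\<lambda>ij. gromov_product \<rho> w (shift (q (fst ij))) (shift (q (snd ij)))) at_top (sequentially \<times>\<^sub>F sequentially)"
  proof (rule filterlim_at_top_affine_bound[OF lim, of "1 / 2" c])
    show "1 / 2 * (case ij of (i, j) \<Rightarrow> gromov_product \<rho> w (q i) (q j)) - c
        \<le> gromov_product \<rho> w (shift (q (fst ij))) (shift (q (snd ij)))" for ij
      using B[OF qY[of "fst ij"] qY[of "snd ij"], THEN abs_le_D1]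
        B[OF shift_Y[OF qY[of "fst ij"]] shift_Y[OF qY[of "snd ij"]], THEN abs_le_D2]
        log_size_shift_le[OF qY[of "fst ij"] qY[of "snd ij"]]
      unfolding c_def case_prod_unfold by (simp add: field_simps)
  qed auto
  then have 1: "gromov_sequence Y \<rho> w (shift \<circ> q)"
    using shift_Y[OF qY] by (simp add: gromov_sequence_def case_prod_unfold image_subset_iff)
  have diag: "filterlim (\<lambda>i. gromov_product \<rho> w (q i) (q i)) at_top sequentially"
    using filterlim_compose[OF lim filterlim_Pair[OF filterlim_ident filterlim_ident]] by simp
  have "filterlim (\<lambda>i. gromov_product \<rho> w (shift (q i)) (q i)) at_top sequentially"
  proof (rule filterlim_at_top_affine_bound[OF diag, of "1 / 2" c])
    fix i
    obtain x s where eq: "q i = (x, s)" by fastforce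
    have h: "x \<in> Z" "0 < s" "s \<le> D" using qY[of i] by (auto simp: eq mem_Y)
    then have l: "ln s \<le> ln D" by simp
    have "s \<le> exp (raise x (ln s))"
    proof -
      have "exp (ln s) \<le> exp (raise x (ln s))" using lift_nonneg[of x "ln s"] by (simp add: raise_def)
      then show ?thesis using h by simp
    qed
    then have "log_size (shift (q i)) (q i) = raise x (ln s)"
      using h by (simp add: log_size_def eq shift_def max_absorb1)
    moreover have "log_size (q i) (q i) = ln s" using h by (simp add: log_size_def eq)
    moreover have "0 \<le> ln (2::real)" by simp
    ultimately show "1 / 2 * gromov_product \<rho> w (q i) (q i) - c \<le> gromov_product \<rho> w (shift (q i)) (q i)"
      using B[OF qY[of i] qY[of i], THEN abs_le_D1] B[OF shift_Y[OF qY[of i]] qY[of i], THEN abs_le_D2]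
        raise_le[OF l, of x] unfolding c_def add_divide_distrib by linarith
  qed auto
  with 1 show "gromov_sequence Y \<rho> w (shift \<circ> q) \<and> gromov_equivalent \<rho> w (shift \<circ> q) q"
    by (simp add: gromov_equivalent_def)
qed

text \<open>In the middle of a gap of logarithmic length \<open>4 * (\<bar>B\<bar> + 1)\<close> the lift is at least
  \<open>\<bar>B\<bar> + 1\<close>, and it is the displacement of the shift.\<close>

lemma uniformly_perfect_of_boundary_rigid:
  assumes rigid: "boundary_rigid Y \<rho>"
  shows "uniformly_perfect Z d"
proof (rule ccontr)
  assume "\<not> uniformly_perfect Z d"
  then have gap: "\<And>S r0. 1 \<le> S \<Longrightarrow> 0 < r0 \<Longrightarrow>
      \<exists>x\<in>Z. \<exists>r. 0 < r \<and> r \<le> r0 \<and> (\<forall>y\<in>Z. r / S < d x y \<longrightarrow> r < d x y)"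
    unfolding uniformly_perfect_def by (meson not_le)
  obtain z0 where "z0 \<in> Z" using nonempty by blast
  then have w: "(z0, D) \<in> Y" using D_pos by (simp add: mem_Y)
  have "bdd_above ((\<lambda>p. \<rho> p (shift p)) ` Y)"
    using rigid[unfolded boundary_rigid_def, rule_format, OF w, of shift]
      quasi_isometry_shift induces_boundary_identity_shift[OF w] by simp
  then obtain B where B: "\<And>p. p \<in> Y \<Longrightarrow> \<rho> p (shift p) \<le> B" by (auto simp: bdd_above_def)
  define S where "S = exp (4 * (\<bar>B\<bar> + 1))"
  have S: "1 \<le> S" by (simp add: S_def)
  obtain x r where x: "x \<in> Z" and r: "0 < r" "r \<le> D" and gap: "\<And>y. y \<in> Z \<Longrightarrow> r / S < d x y \<Longrightarrow> r < d x y"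
    using gap[OF S D_pos] by blast
  define \<tau> where "\<tau> = ln r - 2 * (\<bar>B\<bar> + 1)"
  have "2 * (\<bar>B\<bar> + 1) \<le> (INF e\<in>scales x. dist \<tau> e)"
  proof (rule cINF_greatest)
    show "scales x \<noteq> {}" by (simp add: scales_def)
    fix e assume "e \<in> scales x"
    then consider "e = ln D" | y where "y \<in> Z" "y \<noteq> x" "e = ln (d x y)" by (auto simp: scales_def)
    then show "2 * (\<bar>B\<bar> + 1) \<le> dist \<tau> e"
    proof cases
      case 1
      have "ln r \<le> ln D" using r by simp
      then show ?thesis by (simp add: 1 \<tau>_def dist_real_def)
    next
      case 2
      then have pos: "0 < d x y" using x by (simp add: mdist_pos_less)
      show ?thesis
      proof (cases "r / S < d x y")
        case True
        then have "r < d x y" using gap 2 by blast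
        then have "ln r \<le> ln (d x y)" using r by (intro ln_mono) auto
        then show ?thesis by (simp add: 2 \<tau>_def dist_real_def)
      next
        case False
        then have "ln (d x y) \<le> ln (r / S)" using pos by (intro ln_mono) auto
        also have "\<dots> = ln r - 4 * (\<bar>B\<bar> + 1)" using r by (simp add: S_def ln_div)
        finally show ?thesis by (simp add: 2 \<tau>_def dist_real_def)
      qed
    qed
  qed
  also have "\<dots> = infdist \<tau> (scales x)" by (simp add: infdist_def scales_def)
  finally have big: "\<bar>B\<bar> + 1 \<le> lift x \<tau>" by (simp add: lift_def)
  have "exp \<tau> \<le> exp (ln r)" by (simp add: \<tau>_def)
  then have m: "(x, exp \<tau>) \<in> Y" using x r by (simp add: mem_Y)
  have "\<rho> (x, exp \<tau>) (shift (x, exp \<tau>)) = lift x \<tau>"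
    using x lift_nonneg[of x \<tau>] by (simp add: shift_def \<rho>_vertical raise_def)
  then show False using B[OF m] big by linarith
qed

end


section \<open>Path metrics of graphs\<close>

lemma edge_point_0: "edge_point u v 0 = indicator {u}" and edge_point_1: "edge_point u v 1 = indicator {v}"
  by (auto simp: edge_point_def)

lemma pl_path_nonneg: "pl_path V E p q l \<Longrightarrow> 0 \<le> l"
  by (induction rule: pl_path.induct) auto

lemma edge_point_in_graph_points:
  "u \<in> V \<Longrightarrow> v \<in> V \<Longrightarrow> E u v \<Longrightarrow> t \<in> {0..1} \<Longrightarrow> edge_point u v t \<in> graph_points V E"
  unfolding graph_points_def by auto

lemma pl_path_trans:
  assumes "pl_path V E q r l'" "pl_path V E p q l"
  shows "pl_path V E p r (l + l')"
  using assms
proof (induction rule: pl_path.induct)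
  case (append_segment q u v s l' t)
  then show ?case using pl_path.append_segment[of V E p u v s "l + l'" t] by (simp add: add.assoc)
qed simp

lemma pl_path_segment:
  assumes "u \<in> V" "v \<in> V" "E u v" "s \<in> {0..1}" "t \<in> {0..1}"
  shows "pl_path V E (edge_point u v s) (edge_point u v t) \<bar>s - t\<bar>"
  using pl_path.append_segment[of V E "edge_point u v s" u v s 0 t]
    pl_path.const_path[OF edge_point_in_graph_points[of u V v E s]] assms by simp

lemma pl_path_sym: "pl_path V E p q l \<Longrightarrow> pl_path V E q p l"
proof (induction rule: pl_path.induct)
  case (const_path p)
  then show ?case by (rule pl_path.const_path)
next
  case (append_segment p u v s l t)
  then show ?case
    using pl_path_trans[OF append_segment.IH pl_path_segment[of u V v E t s]]
    by (simp add: add.commute abs_minus_commute)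
qed

text \<open>Since the points of a graph are given by barycentric coordinates, a function on the vertices extends affinely to each edge
  by this one formula. A lower bound for the lengths of paths in the graph then follows from a Lipschitz bound along the edges.\<close>

definition extend :: "('v \<Rightarrow> real) \<Rightarrow> ('v \<Rightarrow> real) \<Rightarrow> real" where
  "extend F p = (\<Sum>w | p w \<noteq> 0. p w * F w)"

lemma extend_edge_point: "extend F (edge_point u v t) = (1 - t) * F u + t * F v"
proof -
  have "extend F (edge_point u v t) = (\<Sum>w\<in>{u, v}. edge_point u v t w * F w)"
    unfolding extend_def by (rule sum.mono_neutral_left) (auto simp: edge_point_def indicator_def split: if_splits)
  also have "\<dots> = (1 - t) * F u + t * F v"
    by (cases "u = v") (auto simp: edge_point_def algebra_simps)
  finally show ?thesis .
qed

lemma pl_path_extend_le: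
  assumes lip: "\<And>u v. u \<in> V \<Longrightarrow> v \<in> V \<Longrightarrow> E u v \<Longrightarrow> \<bar>F u - F v\<bar> \<le> 1"
  shows "pl_path V E p q l \<Longrightarrow> \<bar>extend F p - extend F q\<bar> \<le> l"
proof (induction rule: pl_path.induct)
  case (append_segment p u v s l t)
  have "extend F (edge_point u v s) - extend F (edge_point u v t) = (s - t) * (F v - F u)"
    by (simp add: extend_edge_point algebra_simps)
  then have "\<bar>extend F (edge_point u v s) - extend F (edge_point u v t)\<bar> = \<bar>s - t\<bar> * \<bar>F u - F v\<bar>"
    by (simp add: abs_mult abs_minus_commute)
  also have "\<dots> \<le> \<bar>s - t\<bar> * 1" using lip append_segment by (intro mult_left_mono) auto
  finally show ?case using append_segment.IH by (auto simp: abs_le_iff)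
qed simp

locale connected_graph =
  fixes V :: "'v set" and E :: "'v \<Rightarrow> 'v \<Rightarrow> bool"
  assumes edge_sym: "E u v \<Longrightarrow> E v u"
    and connected: "u \<in> V \<Longrightarrow> v \<in> V \<Longrightarrow> \<exists>k. ((\<lambda>u v. u \<in> V \<and> v \<in> V \<and> E u v) ^^ k) u v"
begin

abbreviation step :: "'v \<Rightarrow> 'v \<Rightarrow> bool" where
  "step \<equiv> \<lambda>u v. u \<in> V \<and> v \<in> V \<and> E u v"

definition edge_count :: "'v \<Rightarrow> 'v \<Rightarrow> nat" where
  "edge_count u v = (LEAST k. (step ^^ k) u v)"

lemma edge_count_walk: "u \<in> V \<Longrightarrow> v \<in> V \<Longrightarrow> (step ^^ edge_count u v) u v"
  unfolding edge_count_def using connected by (rule LeastI_ex)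

lemma edge_count_le: "(step ^^ k) u v \<Longrightarrow> edge_count u v \<le> k"
  unfolding edge_count_def by (rule Least_le)

lemma edge_count_step:
  assumes u: "u \<in> V" and vv': "v \<in> V" "v' \<in> V" "E v v'"
  shows "\<bar>real (edge_count u v) - real (edge_count u v')\<bar> \<le> 1"
proof -
  have "edge_count u b \<le> Suc (edge_count u a)" if "a \<in> V" "b \<in> V" "E a b" for a b
    using edge_count_walk[OF u that(1)] that by (intro edge_count_le relpowp_Suc_I) auto
  from this[of v v'] this[of v' v] show ?thesis using vv' edge_sym by auto
qed

lemma pl_path_of_walk: "u \<in> V \<Longrightarrow> (step ^^ k) u v \<Longrightarrow> pl_path V E (indicator {u}) (indicator {v}) (real k)"
proof (induction k arbitrary: v)
  case 0
  moreover have "indicator {u} \<in> graph_points V E"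
    using 0 unfolding graph_points_def edge_point_0[of u u, symmetric] by force
  ultimately show ?case by (auto intro: pl_path.const_path)
next
  case (Suc k)
  then obtain v' where v': "(step ^^ k) u v'" "v' \<in> V" "v \<in> V" "E v' v" by (elim relpowp_Suc_E) auto
  show ?case
    using pl_path_trans[OF _ Suc.IH[OF Suc.prems(1) v'(1)], of "indicator {v}" 1] pl_path_segment[of v' V v E 0 1] v'
    by (simp add: edge_point_0 edge_point_1 algebra_simps)
qed

lemma near_vertex:
  assumes "p \<in> graph_points V E"
  obtains u l where "u \<in> V" "l \<le> 1" "pl_path V E p (indicator {u}) l"
proof -
  obtain u v t where p: "p = edge_point u v t" "u \<in> V" "v \<in> V" "u = v \<or> E u v" "0 \<le> t" "t \<le> 1"
    using assms unfolding graph_points_def by blast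
  show thesis
  proof (cases "E u v")
    case True
    then show thesis
      using that[OF p(2), of "\<bar>t - 0\<bar>"] pl_path_segment[of u V v E t 0] p by (simp add: edge_point_0)
  next
    case False
    then have "p = indicator {u}" using p by (auto simp: edge_point_def fun_eq_iff indicator_def)
    then show thesis using that[OF p(2), of 0] pl_path.const_path[OF assms] by simp
  qed
qed

lemma pl_path_exists:
  assumes "p \<in> graph_points V E" "q \<in> graph_points V E"
  shows "\<exists>l. pl_path V E p q l"
proof -
  obtain u l where u: "u \<in> V" "pl_path V E p (indicator {u}) l" using near_vertex[OF assms(1)] by blast
  obtain v m where v: "v \<in> V" "pl_path V E q (indicator {v}) m" using near_vertex[OF assms(2)] by blast
  have "pl_path V E (indicator {u}) (indicator {v}) (edge_count u v)"
    by (rule pl_path_of_walk[OF u(1) edge_count_walk[OF u(1) v(1)]])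
  from pl_path_trans[OF pl_path_sym[OF v(2)] pl_path_trans[OF this u(2)]] show ?thesis by blast
qed

lemma graph_dist_le: "pl_path V E p q l \<Longrightarrow> graph_dist V E p q \<le> l"
  unfolding graph_dist_def by (intro cInf_lower) (auto intro!: bdd_belowI[of _ 0] dest: pl_path_nonneg)

lemma graph_dist_ge:
  assumes "p \<in> graph_points V E" "q \<in> graph_points V E" "\<And>l. pl_path V E p q l \<Longrightarrow> c \<le> l"
  shows "c \<le> graph_dist V E p q"
  unfolding graph_dist_def using assms pl_path_exists by (intro cInf_greatest) auto

lemma pseudometric_graph_dist: "pseudometric (graph_points V E) (graph_dist V E)"
proof
  fix p q r assume pqr: "p \<in> graph_points V E" "q \<in> graph_points V E" "r \<in> graph_points V E"
  have "graph_dist V E p r - l \<le> graph_dist V E q r" if l: "pl_path V E p q l" for l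
  proof (rule graph_dist_ge[OF pqr(2,3)])
    fix m assume "pl_path V E q r m"
    then show "graph_dist V E p r - l \<le> m" using graph_dist_le[OF pl_path_trans[OF _ l]] by fastforce
  qed
  then have "graph_dist V E p r - graph_dist V E q r \<le> l" if l: "pl_path V E p q l" for l
    using that by fastforce
  from graph_dist_ge[OF pqr(1,2) this] show "graph_dist V E p r \<le> graph_dist V E p q + graph_dist V E q r" by simp
next
  fix p q assume pq: "p \<in> graph_points V E" "q \<in> graph_points V E"
  show "0 \<le> graph_dist V E p q" using pq by (rule graph_dist_ge) (rule pl_path_nonneg)
  have "{l. pl_path V E p q l} = {l. pl_path V E q p l}" using pl_path_sym by auto
  then show "graph_dist V E p q = graph_dist V E q p" by (simp add: graph_dist_def)
next
  fix p assume p: "p \<in> graph_points V E"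
  show "graph_dist V E p p = 0"
    using graph_dist_le[OF pl_path.const_path[OF p]] graph_dist_ge[OF p p pl_path_nonneg] by force
qed

lemma vertex_in_graph_points: "u \<in> V \<Longrightarrow> indicator {u} \<in> graph_points V E"
  unfolding graph_points_def edge_point_0[of u u, symmetric] by force

text \<open>The number of edges from \<open>u\<close> changes by at most 1 along an edge, so its affine extension
  changes along a path by at most the length of the path.\<close>

lemma graph_dist_vertices:
  assumes u: "u \<in> V" and v: "v \<in> V"
  shows "graph_dist V E (indicator {u}) (indicator {v}) = real (edge_count u v)"
proof (rule antisym)
  show "graph_dist V E (indicator {u}) (indicator {v}) \<le> real (edge_count u v)"
    using u by (intro graph_dist_le pl_path_of_walk edge_count_walk u v)
  let ?F = "\<lambda>w. real (edge_count u w)"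
  have F: "extend ?F (indicator {w}) = ?F w" for w
    using extend_edge_point[of ?F w w 0] by (simp add: edge_point_0)
  have "edge_count u u \<le> 0" by (rule edge_count_le) simp
  then have 0: "edge_count u u = 0" by simp
  show "real (edge_count u v) \<le> graph_dist V E (indicator {u}) (indicator {v})"
  proof (rule graph_dist_ge)
    fix l assume "pl_path V E (indicator {u}) (indicator {v}) l"
    from pl_path_extend_le[where F = ?F, OF edge_count_step[OF u] this] show "real (edge_count u v) \<le> l"
      unfolding F 0 by simp
  qed (use u v vertex_in_graph_points in auto)
qed

text \<open>The vertices with the edge count are isometric to a subset of the graph that comes within distance 1
  of each point, so the graph and any space roughly similar to the vertices have the same rigidity.\<close>

lemma boundary_rigid_graph:
  assumes X: "pseudometric X d'" 
    and \<phi>: "rough_similarity V (\<lambda>u v. real (edge_count u v)) X d' \<phi> \<mu> C"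
  shows "boundary_rigid (graph_points V E) (graph_dist V E) \<longleftrightarrow> boundary_rigid X d'"
proof -
  interpret G: pseudometric "graph_points V E" "graph_dist V E" by (rule pseudometric_graph_dist)
  have V: "pseudometric V (\<lambda>u v. real (edge_count u v))"
  proof
    fix u v w assume uvw: "u \<in> V" "v \<in> V" "w \<in> V"
    show "real (edge_count u w) \<le> real (edge_count u v) + real (edge_count v w)"
      using G.tri[of "indicator {u}" "indicator {v}" "indicator {w}"] uvw
      by (simp add: graph_dist_vertices vertex_in_graph_points)
  next
    fix u v assume uv: "u \<in> V" "v \<in> V"
    show "real (edge_count u v) = real (edge_count v u)"
      using G.sym[of "indicator {u}" "indicator {v}"] uv by (simp add: graph_dist_vertices vertex_in_graph_points)
  next
    fix u assume u: "u \<in> V"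
    show "real (edge_count u u) = 0"
      using G.refl[of "indicator {u}"] u by (simp add: graph_dist_vertices vertex_in_graph_points)
  qed simp
  have "rough_similarity V (\<lambda>u v. real (edge_count u v)) (graph_points V E) (graph_dist V E) (\<lambda>v. indicator {v}) 1 1"
    unfolding rough_similarity_def
  proof (intro conjI ballI)
    fix p assume "p \<in> graph_points V E"
    then obtain u l where "u \<in> V" "l \<le> 1" "pl_path V E p (indicator {u}) l" by (rule near_vertex)
    then show "\<exists>u\<in>V. graph_dist V E p (indicator {u}) \<le> 1" by (meson graph_dist_le order_trans)
  qed (auto simp: graph_dist_vertices vertex_in_graph_points)
  then show ?thesis
    using boundary_rigid_rough_similarity[OF V pseudometric_graph_dist] boundary_rigid_rough_similarity[OF V X \<phi>] by blast
qed

end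


section \<open>Graphs that fill a cone\<close>

text \<open>The tangent of the concave function \<open>ln\<close> at \<open>1 / a\<close> lies above its graph.\<close>

lemma ln_le_linear:
  assumes "0 < a" "0 < x" shows "ln x \<le> a * x - 1 - ln (a::real)"
  using ln_le_minus_one[of "a * x"] assms by (simp add: ln_mult)

text \<open>A vertex at level \<open>k\<close> stands for the point of the cone at height \<open>r powi k\<close>
  over its centre. Edges join only vertices that are close to each other in the cone, and conversely join all pairs of vertices of
  the same level or of consecutive levels whose centres are close to a common point at the scale of their levels.\<close>

locale filling_graph = hyperbolic_cone Z d D for Z :: "'a set" and d D +
  fixes r :: real and k0 :: int
    and V :: "'v set" and E :: "'v \<Rightarrow> 'v \<Rightarrow> bool"
    and centre :: "'v \<Rightarrow> 'a" and level :: "'v \<Rightarrow> int"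
  assumes r: "0 < r" "r \<le> 1 / 2" and D_eq: "D = r powi k0"
    and dist_less: "x \<in> Z \<Longrightarrow> y \<in> Z \<Longrightarrow> d x y < r powi k0"
    and centre: "v \<in> V \<Longrightarrow> centre v \<in> Z" and level: "v \<in> V \<Longrightarrow> k0 \<le> level v"
    and cover: "x \<in> Z \<Longrightarrow> k0 \<le> k \<Longrightarrow> \<exists>v\<in>V. level v = k \<and> d x (centre v) < r powi k"
    and edge_sym: "E u v \<Longrightarrow> E v u"
    and edge_level: "u \<in> V \<Longrightarrow> v \<in> V \<Longrightarrow> E u v \<Longrightarrow> \<bar>level u - level v\<bar> \<le> 1"
    and edge_dist: "u \<in> V \<Longrightarrow> v \<in> V \<Longrightarrow> E u v \<Longrightarrow> d (centre u) (centre v) \<le> 4 * r powi (min (level u) (level v))"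
    and horizontal_edge: "u \<in> V \<Longrightarrow> v \<in> V \<Longrightarrow> u \<noteq> v \<Longrightarrow> level u = level v \<Longrightarrow> y \<in> Z \<Longrightarrow>
      d y (centre u) < 2 * r powi (level u) \<Longrightarrow> d y (centre v) < 2 * r powi (level v) \<Longrightarrow> E u v"
    and vertical_edge: "u \<in> V \<Longrightarrow> v \<in> V \<Longrightarrow> level u = level v + 1 \<Longrightarrow> x \<in> Z \<Longrightarrow>
      d x (centre u) < r powi (level u) \<Longrightarrow> d x (centre v) < r powi (level v) \<Longrightarrow> E u v"
begin

abbreviation adj :: "'v \<Rightarrow> 'v \<Rightarrow> bool" where
  "adj \<equiv> \<lambda>u v. u \<in> V \<and> v \<in> V \<and> E u v"

lemma powi_pos [simp]: "0 < r powi k"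
  using r by simp

lemma powi_Suc: "r powi (k + 1) = r * r powi k"
  using r by (simp add: power_int_add)

lemma powi_antimono: "j \<le> k \<Longrightarrow> r powi k \<le> r powi j"
  using r by (intro power_int_decreasing) auto

lemma ln_powi: "ln (r powi k) = real_of_int k * ln r"
  using r by (simp add: power_int_def ln_realpow ln_inverse)

lemma walk_sym: "(adj ^^ k) u v \<Longrightarrow> (adj ^^ k) v u"
proof (induction k arbitrary: v)
  case (Suc k)
  then obtain v' where "(adj ^^ k) u v'" "adj v' v" by (elim relpowp_Suc_E)
  then show ?case using Suc.IH edge_sym by (intro relpowp_Suc_I2[of adj v v']) auto
qed auto

text \<open>The centres along the walk stay close to the same point \<open>x\<close>, each at the scale of its level.\<close>

lemma ascend:
  assumes x: "x \<in> Z" and v: "v \<in> V" "d x (centre v) < r powi (level v)" and j: "k0 \<le> j" "j \<le> level v"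
  obtains u where "u \<in> V" "level u = j" "d x (centre u) < r powi j" "(adj ^^ nat (level v - j)) v u"
proof -
  have "\<exists>u\<in>V. level u = level v - int i \<and> d x (centre u) < r powi (level u) \<and> (adj ^^ i) v u"
    if "k0 \<le> level v - int i" for i
    using that
  proof (induction i)
    case 0
    then show ?case using v by (intro bexI[of _ v]) auto
  next
    case (Suc i)
    then obtain u where u: "u \<in> V" "level u = level v - int i" "d x (centre u) < r powi (level u)" "(adj ^^ i) v u"
      by auto
    obtain u' where u': "u' \<in> V" "level u' = level v - int (Suc i)" "d x (centre u') < r powi (level v - int (Suc i))"
      using cover[OF x Suc.prems] by blast
    have "E u u'" using u u' by (intro vertical_edge[OF u(1) u'(1) _ x]) auto
    then show ?case using u u' by (intro bexI[of _ u'] conjI relpowp_Suc_I[of i adj v u]) auto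
  qed
  from this[of "nat (level v - j)"] j show thesis by (auto intro: that)
qed

text \<open>Go up from both vertices to level \<open>j\<close>, where the vertices reached are at most one edge apart.\<close>

lemma short_walk:
  assumes u: "u \<in> V" and v: "v \<in> V"
    and j: "k0 \<le> j" "j \<le> level u" "j \<le> level v" and close: "d (centre u) (centre v) < r powi j"
  obtains k where "(adj ^^ k) u v" "int k \<le> level u + level v - 2 * j + 1"
proof -
  have uu: "d (centre u) (centre u) < r powi (level u)" "d (centre v) (centre v) < r powi (level v)"
    using centre u v by simp_all
  obtain u' where u': "u' \<in> V" "level u' = j" "d (centre u) (centre u') < r powi j" "(adj ^^ nat (level u - j)) u u'"
    using ascend[OF centre[OF u] u uu(1) j(1,2)] .
  obtain v' where v': "v' \<in> V" "level v' = j" "d (centre v) (centre v') < r powi j" "(adj ^^ nat (level v - j)) v v'"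
    using ascend[OF centre[OF v] v uu(2) j(1,3)] .
  let ?n = "nat (level u - j)" and ?m = "nat (level v - j)"
  note wv = walk_sym[OF v'(4)]
  show thesis
  proof (cases "u' = v'")
    case True
    then have "(adj ^^ (?n + ?m)) u v" using u'(4) wv unfolding relpowp_add by auto
    then show thesis using j by (intro that) auto
  next
    case False
    have "d (centre v) (centre u') < 2 * r powi j"
      using triangle[OF centre[OF v] centre[OF u] centre[OF u'(1)]] close u'(3) commute[of "centre u" "centre v"] by linarith
    moreover have "d (centre v) (centre v') < 2 * r powi j" using v'(3) powi_pos[of j] by linarith
    ultimately have "E u' v'" using u' v' by (intro horizontal_edge[OF u'(1) v'(1) False _ centre[OF v]]) auto
    then have "(adj ^^ Suc ?n) u v'" using u' v' by (intro relpowp_Suc_I[of _ adj u u']) auto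
    then have "(adj ^^ (Suc ?n + ?m)) u v" using wv unfolding relpowp_add by blast
    then show thesis by (rule that) (use j in auto)
  qed
qed

sublocale connected_graph V E
proof
  fix u v assume uv: "u \<in> V" "v \<in> V"
  show "\<exists>k. (adj ^^ k) u v"
    using short_walk[OF uv _ level[OF uv(1)] level[OF uv(2)] dist_less[OF centre[OF uv(1)] centre[OF uv(2)]]]
    by blast
qed (rule edge_sym)

text \<open>Here \<open>j\<close> is the level at which a walk from \<open>u\<close> to \<open>v\<close> turns, and a walk that only climbs to level \<open>j\<close> and
  descends again has \<open>level u + level v - 2 * j\<close> edges. Each further edge moves the centre by at most a multiple of
  \<open>r powi j\<close>. The descent contributes a geometric series, whose remaining part is accounted for by the
  summand \<open>- r powi (level v)\<close>.\<close>

lemma walk_dist: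
  assumes u: "u \<in> V"
  shows "(adj ^^ k) u v \<Longrightarrow> \<exists>j \<le> level v. j \<le> level u \<and> level u + level v - 2 * j \<le> int k \<and>
    d (centre u) (centre v)
      \<le> 8 * (r powi j * (real k - real_of_int (level u + level v - 2 * j) + 2) - r powi (level v))"
proof (induction k arbitrary: v)
  case 0
  then show ?case using u centre by (intro exI[of _ "level u"]) (auto simp: algebra_simps less_imp_le)
next
  case (Suc k)
  then obtain v' where w: "(adj ^^ k) u v'" and v': "v' \<in> V" "v \<in> V" "E v' v" by (elim relpowp_Suc_E) auto
  let ?n = "level u" and ?m = "level v'" and ?m' = "level v"
  obtain j where j: "j \<le> ?m" "j \<le> ?n" "?n + ?m - 2 * j \<le> int k"
    and dist: "d (centre u) (centre v') \<le> 8 * (r powi j * (real k - real_of_int (?n + ?m - 2 * j) + 2) - r powi ?m)"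
    using Suc.IH[OF w] by blast
  define L where "L = real k - real_of_int (?n + ?m - 2 * j)"
  have L: "0 \<le> L" using j(3) unfolding L_def by linarith
  have tri: "d (centre u) (centre v) \<le> 8 * (r powi j * (L + 2) - r powi ?m) + 4 * r powi (min ?m ?m')"
    using triangle[OF centre[OF u] centre[OF v'(1)] centre[OF v'(2)]] edge_dist[OF v'] dist unfolding L_def by linarith
  have half: "r powi (i + 1) \<le> r powi i / 2" for i
    unfolding powi_Suc using r mult_right_mono[of r "1/2" "r powi i"] by simp
  consider "?m' = ?m + 1" | "?m' = ?m" | "?m' = ?m - 1" "j \<le> ?m'" | "?m' = ?m - 1" "j = ?m"
    using edge_level[OF v'] j(1) by linarith
  then show ?case
  proof cases
    case 1
    have "real (Suc k) - real_of_int (?n + ?m' - 2 * j) = L" by (simp add: L_def 1)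
    moreover have "d (centre u) (centre v) \<le> 8 * (r powi j * (L + 2) - r powi ?m')"
      using tri half[of ?m] by (simp add: 1)
    ultimately show ?thesis using j 1 by (intro exI[of _ j]) auto
  next
    case 2
    have "real (Suc k) - real_of_int (?n + ?m' - 2 * j) = L + 1" by (simp add: L_def 2)
    moreover have "d (centre u) (centre v) \<le> 8 * (r powi j * (L + 1 + 2) - r powi ?m')"
      using tri powi_antimono[OF j(1)] powi_pos[of ?m] by (simp add: 2 algebra_simps del: powi_pos)
    ultimately show ?thesis using j 2 by (intro exI[of _ j]) auto
  next
    case 3
    have "real (Suc k) - real_of_int (?n + ?m' - 2 * j) = L + 2" by (simp add: L_def 3)
    moreover have "d (centre u) (centre v) \<le> 8 * (r powi j * (L + 2 + 2) - r powi ?m')"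
    proof -
      have "min ?m ?m' = ?m'" using 3(1) by simp
      then show ?thesis
        using tri powi_antimono[OF 3(2)] powi_pos[of ?m] powi_pos[of ?m']
        by (simp add: algebra_simps del: powi_pos)
    qed
    ultimately show ?thesis using j 3 by (intro exI[of _ j]) auto
  next
    case 4
    have "real (Suc k) - real_of_int (?n + ?m' - 2 * ?m') = L" by (simp add: L_def 4)
    moreover have "d (centre u) (centre v) \<le> 8 * (r powi ?m' * (L + 2) - r powi ?m')"
    proof -
      have h: "r powi ?m \<le> r powi ?m' / 2" using half[of ?m'] 4(1) by simp
      have "r powi ?m * (L + 1) \<le> r powi ?m' / 2 * (L + 1)" using L h by (intro mult_right_mono) auto
      moreover have "r powi ?m' * 1 \<le> r powi ?m' * (L + 1)" using L by (intro mult_left_mono) (auto simp: less_imp_le)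
      moreover have "r powi j = r powi ?m" "r powi (min ?m ?m') = r powi ?m'" using 4 by simp_all
      ultimately show ?thesis using tri by (simp add: algebra_simps del: powi_pos)
    qed
    ultimately show ?thesis using j 4 by (intro exI[of _ ?m']) auto
  qed
qed

definition cone_point :: "'v \<Rightarrow> 'a \<times> real" where
  "cone_point v = (centre v, r powi (level v))"

lemma cone_point_Y: "v \<in> V \<Longrightarrow> cone_point v \<in> Y"
  using centre powi_antimono[OF level, of v] unfolding cone_point_def mem_Y D_eq[symmetric] by simp

lemma \<rho>_cone_point:
  assumes "u \<in> V" "v \<in> V"
  shows "\<rho> (cone_point u) (cone_point v)
    = 2 * ln (d (centre u) (centre v) + max (r powi (level u)) (r powi (level v))) - real_of_int (level u + level v) * ln r"
  using assms centre by (simp add: cone_point_def \<rho>_eq ln_powi algebra_simps)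

text \<open>With \<open>\<Lambda> = - ln r\<close>, a walk with turning level \<open>j\<close> and \<open>L\<close> spare edges gives
  \<open>\<rho> \<le> \<Lambda> * (k - L) + 2 * ln (8 * L + 17)\<close>, and \<open>2 * ln (8 * L + 17)\<close> exceeds \<open>\<Lambda> * L\<close> by a bounded amount only.
  Conversely, the short walk turns at the deepest level at which the two centres are still close.\<close>

lemma rough_similarity_cone_point:
  "\<exists>C. rough_similarity V (\<lambda>u v. real (edge_count u v)) Y \<rho> cone_point (- ln r) C"
proof -
  define \<Lambda> where "\<Lambda> = - ln r"
  have \<Lambda>: "0 < \<Lambda>" using r by (simp add: \<Lambda>_def)
  have l2: "0 \<le> ln (2::real)" by simp
  define C where "C = \<bar>17 / 8 * \<Lambda> - 2 - 2 * ln (\<Lambda> / 16)\<bar> + 3 * \<Lambda> + 2 * ln 2"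
  have upper: "\<rho> (cone_point u) (cone_point v) \<le> \<Lambda> * real (edge_count u v) + C" if u: "u \<in> V" and v: "v \<in> V" for u v
  proof -
    let ?n = "level u" and ?m = "level v" and ?k = "edge_count u v"
    obtain j where j: "j \<le> ?m" "j \<le> ?n" "?n + ?m - 2 * j \<le> int ?k"
      and dist: "d (centre u) (centre v) \<le> 8 * (r powi j * (real ?k - real_of_int (?n + ?m - 2 * j) + 2) - r powi ?m)"
      using walk_dist[OF u edge_count_walk[OF u v]] by blast
    define L where "L = real ?k - real_of_int (?n + ?m - 2 * j)"
    have L: "0 \<le> L" using j(3) unfolding L_def by linarith
    let ?s = "d (centre u) (centre v) + max (r powi ?n) (r powi ?m)"
    have pos: "0 < ?s" by (intro pos_dist_add) (simp add: less_max_iff_disj)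
    have "?s \<le> r powi j * (8 * L + 17)"
    proof -
      have "max (r powi ?n) (r powi ?m) \<le> r powi j" using powi_antimono j by simp
      moreover have "8 * (r powi j * (L + 2) - r powi ?m) = 8 * (r powi j * L) + 16 * r powi j - 8 * r powi ?m"
        and "r powi j * (8 * L + 17) = 8 * (r powi j * L) + 17 * r powi j"
        by (simp_all add: algebra_simps)
      ultimately show ?thesis using dist powi_pos[of ?m] unfolding L_def[symmetric] by linarith
    qed
    then have "ln ?s \<le> ln (r powi j * (8 * L + 17))" using pos by (intro ln_mono) auto
    also have "\<dots> = real_of_int j * ln r + ln (8 * L + 17)" using L r by (simp add: ln_mult ln_powi)
    finally have "ln ?s \<le> - (real_of_int j * \<Lambda>) + ln (8 * L + 17)" by (simp add: \<Lambda>_def)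
    \<comment> \<open>The slope \<open>\<Lambda> / 16\<close> makes the linear part equal to \<open>\<Lambda> * L / 2\<close>.\<close>
    moreover have "ln (8 * L + 17) \<le> \<Lambda> / 16 * (8 * L + 17) - 1 - ln (\<Lambda> / 16)"
      using L \<Lambda> by (intro ln_le_linear) auto
    moreover have "\<Lambda> / 16 * (8 * L + 17) = \<Lambda> * L / 2 + 17 / 16 * \<Lambda>" by (simp add: algebra_simps)
    ultimately have "2 * ln ?s \<le> - (2 * (real_of_int j * \<Lambda>)) + \<Lambda> * L + (17 / 8 * \<Lambda> - 2 - 2 * ln (\<Lambda> / 16))" by linarith
    moreover have "\<rho> (cone_point u) (cone_point v) = 2 * ln ?s + real_of_int (?n + ?m) * \<Lambda>"
      using \<rho>_cone_point[OF u v] by (simp add: \<Lambda>_def)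
    moreover have "\<Lambda> * L = \<Lambda> * real ?k - (real_of_int (?n + ?m) * \<Lambda> - 2 * (real_of_int j * \<Lambda>))"
      by (simp add: L_def algebra_simps)
    moreover have "17 / 8 * \<Lambda> - 2 - 2 * ln (\<Lambda> / 16) \<le> C" using \<Lambda> l2 unfolding C_def by linarith
    ultimately show ?thesis by linarith
  qed
  have lower: "\<Lambda> * real (edge_count u v) - C \<le> \<rho> (cone_point u) (cone_point v)" if u: "u \<in> V" and v: "v \<in> V" for u v
  proof -
    let ?n = "level u" and ?m = "level v" and ?k = "edge_count u v"
    let ?s = "d (centre u) (centre v) + max (r powi ?n) (r powi ?m)"
    define J where "J = {j. k0 \<le> j \<and> j \<le> min ?n ?m \<and> d (centre u) (centre v) < r powi j}"
    have fin: "finite J" by (rule finite_subset[of _ "{k0..min ?n ?m}"]) (auto simp: J_def)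
    have "k0 \<in> J" using dist_less[OF centre[OF u] centre[OF v]] level u v by (auto simp: J_def)
    then have MJ: "Max J \<in> J" using fin by (intro Max_in) auto
    define j where "j = Max J"
    have j: "k0 \<le> j" "j \<le> ?n" "j \<le> ?m" "d (centre u) (centre v) < r powi j" using MJ by (auto simp: J_def j_def)
    have "j + 1 \<notin> J" using Max_ge[OF fin, of "j + 1"] by (auto simp: j_def)
    then have "j = ?n \<or> j = ?m \<or> r powi (j + 1) \<le> d (centre u) (centre v)" using j by (auto simp: J_def)
    then have "r powi (j + 1) \<le> ?s"
    proof -
      have "r powi (j + 1) \<le> r powi j" by (rule powi_antimono) simp
      then have "r powi (j + 1) \<le> max (r powi ?n) (r powi ?m) \<or> r powi (j + 1) \<le> d (centre u) (centre v)"
        using \<open>j = ?n \<or> j = ?m \<or> r powi (j + 1) \<le> d (centre u) (centre v)\<close> by (auto simp: le_max_iff_disj)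
      moreover have "0 < max (r powi ?n) (r powi ?m)" by (simp add: less_max_iff_disj)
      ultimately show ?thesis using nonneg[of "centre u" "centre v"] by (elim disjE) linarith+
    qed
    then have "ln (r powi (j + 1)) \<le> ln ?s" by (intro ln_mono) auto
    then have "- (real_of_int (j + 1) * \<Lambda>) \<le> ln ?s" by (simp add: ln_powi \<Lambda>_def)
    moreover have "\<rho> (cone_point u) (cone_point v) = 2 * ln ?s + real_of_int (?n + ?m) * \<Lambda>"
      using \<rho>_cone_point[OF u v] by (simp add: \<Lambda>_def)
    moreover obtain k where k: "(adj ^^ k) u v" "int k \<le> ?n + ?m - 2 * j + 1"
      using short_walk[OF u v j] .
    moreover have "\<Lambda> * real ?k \<le> \<Lambda> * real_of_int (?n + ?m - 2 * j + 1)"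
      using edge_count_le[OF k(1)] k(2) \<Lambda> by (intro mult_left_mono) linarith+
    moreover have "3 * \<Lambda> \<le> C" by (simp add: C_def)
    ultimately show ?thesis by (simp add: algebra_simps)
  qed
  have onto: "\<exists>v\<in>V. \<rho> p (cone_point v) \<le> C" if p: "p \<in> Y" for p
  proof -
    obtain x s where eq: "p = (x, s)" by fastforce
    have h: "x \<in> Z" "0 < s" "s \<le> D" using p by (auto simp: eq mem_Y)
    define k where "k = \<lfloor>- ln s / \<Lambda>\<rfloor>"
    have "ln s \<le> real_of_int k0 * ln r" using h(2,3) unfolding D_eq ln_powi[symmetric] by (intro ln_mono) auto
    then have "real_of_int k0 \<le> - ln s / \<Lambda>" using \<Lambda> by (simp add: \<Lambda>_def field_simps)
    then have k0: "k0 \<le> k" by (simp add: k_def le_floor_iff)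
    have "real_of_int k \<le> - ln s / \<Lambda>" "- ln s / \<Lambda> < real_of_int k + 1" unfolding k_def by linarith+
    then have k: "real_of_int k * \<Lambda> \<le> - ln s" "- ln s \<le> real_of_int k * \<Lambda> + \<Lambda>" using \<Lambda> by (simp_all add: field_simps)
    obtain v where v: "v \<in> V" "level v = k" "d x (centre v) < r powi k" using cover[OF h(1) k0] by blast
    have "ln s \<le> ln (r powi k)" using k(1) by (simp add: ln_powi \<Lambda>_def)
    then have "s \<le> r powi k" using h by simp
    then have "d x (centre v) + max s (r powi k) \<le> 2 * r powi k" using v(3) by simp
    then have "ln (d x (centre v) + max s (r powi k)) \<le> ln (2 * r powi k)"
      by (intro ln_mono) (auto intro!: pos_dist_add simp: less_max_iff_disj)
    also have "\<dots> = ln 2 - real_of_int k * \<Lambda>" using r by (simp add: ln_mult ln_powi \<Lambda>_def)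
    finally have "\<rho> p (cone_point v) \<le> 2 * ln 2 - real_of_int k * \<Lambda> - ln s"
      using h by (simp add: eq cone_point_def \<rho>_eq v(2) ln_powi \<Lambda>_def)
    also have "\<dots> \<le> C" using k \<Lambda> by (simp add: C_def)
    finally show ?thesis using v(1) by blast
  qed
  show ?thesis
    unfolding rough_similarity_def \<Lambda>_def[symmetric]
  proof (intro exI[of _ C] conjI ballI)
    fix u v assume uv: "u \<in> V" "v \<in> V"
    show "\<bar>\<rho> (cone_point u) (cone_point v) - \<Lambda> * real (edge_count u v)\<bar> \<le> C"
      using upper[OF uv] lower[OF uv] by (simp add: abs_le_iff)
  qed (use \<Lambda> cone_point_Y onto in auto)
qed

lemma boundary_rigid_iff_cone:
  "boundary_rigid (graph_points V E) (graph_dist V E) \<longleftrightarrow> boundary_rigid Y \<rho>"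
proof -
  obtain C where "rough_similarity V (\<lambda>u v. real (edge_count u v)) Y \<rho> cone_point (- ln r) C"
    using rough_similarity_cone_point by blast
  then show ?thesis by (rule boundary_rigid_graph[OF pseudometric_Y])
qed

end


section \<open>The three fillings\<close>

context hyperbolic_cone
begin

theorem boundary_rigid_iff_uniformly_perfect: "boundary_rigid Y \<rho> \<longleftrightarrow> uniformly_perfect Z d"
  using boundary_rigid_of_uniformly_perfect uniformly_perfect_of_boundary_rigid by blast

end

lemma uniformly_perfect_scale_imp:
  assumes "0 < c" "uniformly_perfect Z d"
  shows "uniformly_perfect Z (\<lambda>x y. c * d x y)"
proof -
  obtain S r0 where S: "1 \<le> S" "0 < r0"
    and up: "\<And>x r. x \<in> Z \<Longrightarrow> 0 < r \<Longrightarrow> r \<le> r0 \<Longrightarrow> \<exists>y\<in>Z. r / S < d x y \<and> d x y \<le> r"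
    using assms(2) unfolding uniformly_perfect_def by blast
  have "\<exists>y\<in>Z. r / S < c * d x y \<and> c * d x y \<le> r" if x: "x \<in> Z" and r: "0 < r" "r \<le> c * r0" for x r
  proof -
    have "0 < r / c" "r / c \<le> r0" using r assms(1) by (simp_all add: pos_divide_le_eq mult.commute)
    then obtain y where "y \<in> Z" "r / c / S < d x y" "d x y \<le> r / c" using up x by blast
    then show ?thesis using assms(1) S by (intro bexI[of _ y]) (auto simp: field_simps)
  qed
  then show ?thesis
    unfolding uniformly_perfect_def using S assms(1) by (intro exI[of _ S] conjI exI[of _ "c * r0"]) auto
qed

lemma uniformly_perfect_scale:
  assumes "0 < c" shows "uniformly_perfect Z (\<lambda>x y. c * d x y) \<longleftrightarrow> uniformly_perfect Z d"
  using uniformly_perfect_scale_imp[of c Z d] uniformly_perfect_scale_imp[of "1 / c" Z "\<lambda>x y. c * d x y"] assms by auto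

lemma dist_le_mdiameter:
  assumes "\<And>x y. x \<in> Z \<Longrightarrow> y \<in> Z \<Longrightarrow> d x y \<le> B" "x \<in> Z" "y \<in> Z"
  shows "d x y \<le> mdiameter Z d"
proof -
  have "bdd_above ((\<lambda>(x, y). d x y) ` (Z \<times> Z))" using assms(1) by (intro bdd_aboveI[of _ B]) auto
  from cSUP_upper[OF _ this, of "(x, y)"] show ?thesis using assms(2,3) by (simp add: mdiameter_def)
qed

context Metric_space
begin

text \<open>Otherwise \<open>x\<close> could be added to the separated set.\<close>

lemma maximal_separated_cover:
  assumes A: "maximal_separated M d a A" and "0 < a" "x \<in> M"
  obtains y where "y \<in> A" "d x y < a"
proof (cases "\<exists>y\<in>A. d x y < a")
  case False
  have A': "A \<subseteq> M" "separated d a A" using A by (auto simp: maximal_separated_def)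
  have "separated d a (insert x A)" using A'(2) False unfolding separated_def by (auto simp: commute not_less)
  then have "insert x A = A" using A A'(1) \<open>x \<in> M\<close> unfolding maximal_separated_def by blast
  then have "x \<in> A" by blast
  then show thesis using that[of x] assms by simp
qed (use that in blast)

lemma bounded_of_compact:
  assumes "compact_space mtopology"
  obtains B where "\<And>x y. x \<in> M \<Longrightarrow> y \<in> M \<Longrightarrow> d x y \<le> B"
proof -
  have "mbounded M" using assms by (intro compactin_imp_mbounded) (simp add: compact_space_def)
  then show thesis using that by (auto simp: mbounded_alt)
qed

lemma scaled_metric: "0 < c \<Longrightarrow> Metric_space M (\<lambda>x y. c * d x y)"
proof
  fix x y z assume "0 < c" "x \<in> M" "y \<in> M" "z \<in> M"
  then show "c * d x z \<le> c * d x y + c * d y z" using triangle by (simp flip: distrib_left)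
qed (auto simp: commute)

lemma bonk_schramm_rigid_iff:
  assumes bounded: "\<And>x y. x \<in> M \<Longrightarrow> y \<in> M \<Longrightarrow> d x y \<le> B" and "M \<noteq> {}"
    and D: "bonk_schramm_height M d D"
  shows "boundary_rigid (bonk_schramm_points M D) (bonk_schramm_dist d) \<longleftrightarrow> uniformly_perfect M d"
proof -
  have le: "d x y \<le> mdiameter M d" if "x \<in> M" "y \<in> M" for x y
    by (rule dist_le_mdiameter[of M d B]) (use bounded that in auto)
  obtain z where z: "z \<in> M" using \<open>M \<noteq> {}\<close> by blast
  have "0 \<le> mdiameter M d" using le[OF z z] z by simp
  then have "0 < D" "mdiameter M d \<le> D"
    using D by (auto simp: bonk_schramm_height_def split: if_splits)
  then have "hyperbolic_cone M d D"
    using le \<open>M \<noteq> {}\<close> by unfold_locales (auto intro: order_trans)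
  then show ?thesis by (rule hyperbolic_cone.boundary_rigid_iff_uniformly_perfect)
qed

text \<open>If two centres are close to a common point at the scale of their levels, then this point lies in both
  balls, which is what an edge requires.\<close>

lemma bourdon_pajot_rigid_iff:
  assumes bounded: "\<And>x y. x \<in> M \<Longrightarrow> y \<in> M \<Longrightarrow> d x y \<le> B" and "M \<noteq> {}"
    and A: "bourdon_pajot_nets M d A"
  shows "boundary_rigid (bourdon_pajot_points M d A) (bourdon_pajot_dist M d A) \<longleftrightarrow> uniformly_perfect M d"
proof -
  have le: "d x y \<le> mdiameter M d" if "x \<in> M" "y \<in> M" for x y
    by (rule dist_le_mdiameter[of M d B]) (use bounded that in auto)
  have less: "d x y < 1" if "x \<in> M" "y \<in> M" for x y
    using le[OF that] A by (simp add: bourdon_pajot_nets_def)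
  have nets: "maximal_separated M d (exp (- real n)) (A n)" for n
    using A by (simp add: bourdon_pajot_nets_def)
  then have sub: "x \<in> M" if "x \<in> A n" for x n using that by (auto simp: maximal_separated_def)
  define r :: real where "r = exp (- 1)"
  have r: "0 < r" "r \<le> 1 / 2"
    using exp_ge_add_one_self[of 1] by (auto simp: r_def exp_minus field_simps)
  have pow: "exp (- real n) = r powi int n" for n
    by (simp add: r_def exp_of_nat_mult[symmetric])
  let ?V = "bourdon_pajot_vertices A" and ?E = "bourdon_pajot_edge M d"
  interpret filling_graph M d 1 r 0 ?V ?E fst "\<lambda>v. int (snd v)"
  proof
    show "0 < r" "r \<le> 1 / 2" by fact+
    show "M \<noteq> {}" by fact
    show "d x y \<le> 1" "d x y < r powi 0" if "x \<in> M" "y \<in> M" for x y using less[OF that] by auto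
    show "fst v \<in> M" if "v \<in> ?V" for v using that sub by (auto simp: bourdon_pajot_vertices_def)
    show "\<exists>v\<in>?V. int (snd v) = k \<and> d x (fst v) < r powi k" if x: "x \<in> M" and k: "0 \<le> k" for x k
    proof -
      obtain y where "y \<in> A (nat k)" "d x y < r powi int (nat k)"
        using maximal_separated_cover[OF nets[unfolded pow, of "nat k"] _ x] r by auto
      then show ?thesis using k by (intro bexI[of _ "(y, nat k)"]) (auto simp: bourdon_pajot_vertices_def)
    qed
    show "?E v u" if "?E u v" for u v
      using that unfolding bourdon_pajot_edge_def by (auto simp: Int_commute abs_minus_commute)
    show "\<bar>int (snd u) - int (snd v)\<bar> \<le> 1" if "?E u v" for u v
      using that unfolding bourdon_pajot_edge_def by (simp add: case_prod_unfold)
    show "d (fst u) (fst v) \<le> 4 * r powi (min (int (snd u)) (int (snd v)))"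
      if "u \<in> ?V" "v \<in> ?V" and uv: "?E u v" for u v
    proof -
      obtain z where z: "z \<in> M" "fst u \<in> M" "fst v \<in> M"
        "d (fst u) z < 2 * r powi int (snd u)" "d (fst v) z < 2 * r powi int (snd v)"
        using uv unfolding bourdon_pajot_edge_def pow by (auto simp: case_prod_unfold)
      have "r powi int (snd u) \<le> r powi (min (int (snd u)) (int (snd v)))"
        "r powi int (snd v) \<le> r powi (min (int (snd u)) (int (snd v)))"
        using r by (intro power_int_decreasing; simp)+
      then show ?thesis using triangle[OF z(2) z(1) z(3)] commute[of z "fst v"] z(4,5) by linarith
    qed
    show "?E u v"
      if "u \<in> ?V" "v \<in> ?V" "u \<noteq> v" "int (snd u) = int (snd v)" "y \<in> M"
        "d y (fst u) < 2 * r powi int (snd u)" "d y (fst v) < 2 * r powi int (snd v)" for u v y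
    proof -
      have "fst u \<in> M" "fst v \<in> M" using that sub by (auto simp: bourdon_pajot_vertices_def)
      then have "y \<in> mball (fst u) (2 * r powi int (snd u)) \<inter> mball (fst v) (2 * r powi int (snd v))"
        using that by (simp add: commute)
      then show ?thesis using that(3,4) unfolding bourdon_pajot_edge_def pow by (auto simp: case_prod_unfold prod_eq_iff)
    qed
    show "?E u v"
      if "u \<in> ?V" "v \<in> ?V" "int (snd u) = int (snd v) + 1" "x \<in> M"
        "d x (fst u) < r powi int (snd u)" "d x (fst v) < r powi int (snd v)" for u v x
    proof -
      have "fst u \<in> M" "fst v \<in> M" using that sub by (auto simp: bourdon_pajot_vertices_def)
      moreover have "0 < r powi int (snd u)" "0 < r powi int (snd v)" using r by simp_all
      ultimately have "x \<in> mball (fst u) (2 * r powi int (snd u)) \<inter> mball (fst v) (2 * r powi int (snd v))"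
        using that by (simp add: commute)
      moreover have "(fst u, snd u) \<noteq> (fst v, snd v)" "\<bar>int (snd u) - int (snd v)\<bar> \<le> 1" using that(3) by auto
      ultimately show ?thesis unfolding bourdon_pajot_edge_def pow case_prod_unfold by blast
    qed
  qed auto
  show ?thesis
    unfolding bourdon_pajot_points_def bourdon_pajot_dist_def
    using boundary_rigid_iff_cone boundary_rigid_iff_uniformly_perfect by blast
qed

text \<open>The vertical edges come from \<open>r \<le> 1 / 6\<close>: if \<open>x\<close> has distance less than
  \<open>r powi (k + 1)\<close> from \<open>u\<close> and less than \<open>r powi k\<close> from \<open>v\<close>, then the ball around \<open>u\<close> lies within
  distance \<open>r powi k + 3 * r powi (k + 1)\<close> of \<open>v\<close>, which is less than \<open>2 * r powi k\<close>.\<close>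

lemma buyalo_schroeder_rigid_iff:
  assumes bounded: "\<And>x y. x \<in> M \<Longrightarrow> y \<in> M \<Longrightarrow> d x y \<le> B" and "M \<noteq> {}"
    and V: "buyalo_schroeder_nets M d r k0 V"
  shows "boundary_rigid (buyalo_schroeder_points M d r k0 V) (buyalo_schroeder_dist M d r k0 V)
    \<longleftrightarrow> uniformly_perfect M d"
proof -
  have le: "d x y \<le> mdiameter M d" if "x \<in> M" "y \<in> M" for x y
    by (rule dist_le_mdiameter[of M d B]) (use bounded that in auto)
  have r: "0 < r" "r \<le> 1 / 6" using V by (auto simp: buyalo_schroeder_nets_def)
  have less: "d x y < r powi k0" if "x \<in> M" "y \<in> M" for x y
    using le[OF that] V by (auto simp: buyalo_schroeder_nets_def split: if_splits)
  have nets: "maximal_separated M d (r powi k) (V k)" if "k0 \<le> k" for k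
    using V that by (auto simp: buyalo_schroeder_nets_def)
  then have sub: "x \<in> M" if "k0 \<le> k" "x \<in> V k" for x k using that by (auto simp: maximal_separated_def)
  let ?V = "buyalo_schroeder_vertices k0 V" and ?E = "buyalo_schroeder_edge M d r"
  have VM: "fst v \<in> M" if "v \<in> ?V" for v using that sub by (auto simp: buyalo_schroeder_vertices_def)
  have pos: "0 < r powi k" for k using r by simp
  interpret filling_graph M d "r powi k0" r k0 ?V ?E fst snd
  proof
    show "0 < r" "r \<le> 1 / 2" using r by auto
    show "M \<noteq> {}" by fact
    show "0 < r powi k0" by (rule pos)
    show "d x y \<le> r powi k0" "d x y < r powi k0" if "x \<in> M" "y \<in> M" for x y using less[OF that] by auto
    show "\<exists>v\<in>?V. snd v = k \<and> d x (fst v) < r powi k" if x: "x \<in> M" and k: "k0 \<le> k" for x k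
    proof -
      obtain y where "y \<in> V k" "d x y < r powi k"
        using maximal_separated_cover[OF nets[OF k] pos x] .
      then show ?thesis using k by (intro bexI[of _ "(y, k)"]) (auto simp: buyalo_schroeder_vertices_def)
    qed
    show "?E v u" if "?E u v" for u v
      using that unfolding buyalo_schroeder_edge_def by (auto simp: Int_commute)
    show "\<bar>snd u - snd v\<bar> \<le> 1" if "?E u v" for u v
      using that unfolding buyalo_schroeder_edge_def by (auto simp: case_prod_unfold)
    show "d (fst u) (fst v) \<le> 4 * r powi (min (snd u) (snd v))"
      if u: "u \<in> ?V" and v: "v \<in> ?V" and "?E u v" for u v
    proof -
      consider "snd u = snd v" "mcball (fst u) (2 * r powi (snd u)) \<inter> mcball (fst v) (2 * r powi (snd v)) \<noteq> {}"
        | "snd u = snd v + 1" "mball (fst u) (2 * r powi (snd u)) \<subseteq> mball (fst v) (2 * r powi (snd v))"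
        | "snd v = snd u + 1" "mball (fst v) (2 * r powi (snd v)) \<subseteq> mball (fst u) (2 * r powi (snd u))"
        using \<open>?E u v\<close> unfolding buyalo_schroeder_edge_def case_prod_unfold by blast
      then show ?thesis
      proof cases
        case 1
        then obtain z where "z \<in> M" "d (fst u) z \<le> 2 * r powi (snd u)" "d (fst v) z \<le> 2 * r powi (snd u)"
          by (auto simp del: mcball_eq_empty)
        then show ?thesis
          using triangle[OF VM[OF u] \<open>z \<in> M\<close> VM[OF v]] commute[of z "fst v"] 1(1) by simp
      next
        case 2
        have "fst u \<in> mball (fst v) (2 * r powi (snd v))" using pos VM[OF u] by (intro subsetD[OF 2(2)]) simp
        then have "d (fst u) (fst v) < 2 * r powi (snd v)" by (simp add: commute)
        then show ?thesis using 2(1) pos[of "snd v"] by simp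
      next
        case 3
        have "fst v \<in> mball (fst u) (2 * r powi (snd u))" using pos VM[OF v] by (intro subsetD[OF 3(2)]) simp
        then have "d (fst u) (fst v) < 2 * r powi (snd u)" by simp
        then show ?thesis using 3(1) pos[of "snd u"] by simp
      qed
    qed
    show "?E u v"
      if "u \<in> ?V" "v \<in> ?V" "u \<noteq> v" "snd u = snd v" "y \<in> M"
        "d y (fst u) < 2 * r powi (snd u)" "d y (fst v) < 2 * r powi (snd v)" for u v y
    proof -
      have "y \<in> mcball (fst u) (2 * r powi (snd u)) \<inter> mcball (fst v) (2 * r powi (snd v))"
        using that VM by (simp add: commute)
      then show ?thesis using that(3,4) unfolding buyalo_schroeder_edge_def by (auto simp: case_prod_unfold prod_eq_iff)
    qed
    show "?E u v"
      if u: "u \<in> ?V" and v: "v \<in> ?V" and lev: "snd u = snd v + 1" and x: "x \<in> M"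
        and xu: "d x (fst u) < r powi (snd u)" and xv: "d x (fst v) < r powi (snd v)" for u v x
    proof -
      have "r powi (snd u) = r * r powi (snd v)" using r unfolding lev by (simp add: power_int_add)
      also have "\<dots> \<le> 1 / 6 * r powi (snd v)" using r pos[of "snd v"] by (intro mult_right_mono) auto
      finally have six: "r powi (snd u) \<le> 1 / 6 * r powi (snd v)" .
      have "mball (fst u) (2 * r powi (snd u)) \<subseteq> mball (fst v) (2 * r powi (snd v))"
      proof
        fix y assume "y \<in> mball (fst u) (2 * r powi (snd u))"
        then have y: "y \<in> M" "d (fst u) y < 2 * r powi (snd u)" by auto
        have "d (fst v) y < 2 * r powi (snd v)"
          using triangle[OF VM[OF v] x y(1)] triangle[OF x VM[OF u] y(1)] commute[of x "fst v"]
            y(2) xu xv six pos[of "snd v"] by linarith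
        then show "y \<in> mball (fst v) (2 * r powi (snd v))" using VM[OF v] y(1) by simp
      qed
      then show ?thesis using lev unfolding buyalo_schroeder_edge_def by (simp add: case_prod_unfold)
    qed
  qed (auto simp: VM buyalo_schroeder_vertices_def)
  show ?thesis
    unfolding buyalo_schroeder_points_def buyalo_schroeder_dist_def
    using boundary_rigid_iff_cone boundary_rigid_iff_uniformly_perfect by blast
qed

end

theorem corollary1p13:
  fixes Z :: "'a set" and d :: "'a \<Rightarrow> 'a \<Rightarrow> real"
  assumes "Metric_space Z d"
    and "compact_space (Metric_space.mtopology Z d)"
    and "Z \<noteq> {}"
  shows
    "(\<forall>D. bonk_schramm_height Z d D \<longrightarrow>
        (boundary_rigid (bonk_schramm_points Z D) (bonk_schramm_dist d)
          \<longleftrightarrow> uniformly_perfect Z d)) \<and>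
     (\<forall>c>0. \<forall>A. bourdon_pajot_nets Z (\<lambda>x y. c * d x y) A \<longrightarrow>
        (boundary_rigid (bourdon_pajot_points Z (\<lambda>x y. c * d x y) A)
            (bourdon_pajot_dist Z (\<lambda>x y. c * d x y) A)
          \<longleftrightarrow> uniformly_perfect Z d)) \<and>
     (\<forall>r k0 V. buyalo_schroeder_nets Z d r k0 V \<longrightarrow>
        (boundary_rigid (buyalo_schroeder_points Z d r k0 V) (buyalo_schroeder_dist Z d r k0 V)
          \<longleftrightarrow> uniformly_perfect Z d))"
proof -
  interpret Metric_space Z d by fact
  obtain B where B: "\<And>x y. x \<in> Z \<Longrightarrow> y \<in> Z \<Longrightarrow> d x y \<le> B"
    using bounded_of_compact assms(2) by blast
  show ?thesis
  proof (intro conjI allI impI)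
    fix c :: real and A
    assume c: "0 < c" and A: "bourdon_pajot_nets Z (\<lambda>x y. c * d x y) A"
    have cB: "c * d x y \<le> c * B" if "x \<in> Z" "y \<in> Z" for x y using B[OF that] c by simp
    show "boundary_rigid (bourdon_pajot_points Z (\<lambda>x y. c * d x y) A) (bourdon_pajot_dist Z (\<lambda>x y. c * d x y) A)
        \<longleftrightarrow> uniformly_perfect Z d"
      using Metric_space.bourdon_pajot_rigid_iff[OF scaled_metric[OF c] cB assms(3) A]
      by (simp add: uniformly_perfect_scale[OF c])
  next
    fix D assume "bonk_schramm_height Z d D"
    from bonk_schramm_rigid_iff[OF B assms(3) this]
    show "boundary_rigid (bonk_schramm_points Z D) (bonk_schramm_dist d) \<longleftrightarrow> uniformly_perfect Z d" .
  next
    fix r k0 V assume "buyalo_schroeder_nets Z d r k0 V"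
    from buyalo_schroeder_rigid_iff[OF B assms(3) this]
    show "boundary_rigid (buyalo_schroeder_points Z d r k0 V) (buyalo_schroeder_dist Z d r k0 V)
      \<longleftrightarrow> uniformly_perfect Z d" .
  qed
qed

end
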